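(* For every bounded function $F\in C(\mathbb{C},\mathbb{R})$ there exists a function $\nu[F]\in C(\Gamma\backslash G,\mathbb{R})$ such that for all $\alpha\in\mathbb{R}$, all $t$ with $N=\mathrm{e}^{t/2}\in\mathbb{N}$, all $k\in\mathbb{Z}$ and all $\ell\in\mathbb{Z}\setminus\{0\}$, $$\mathbb{E}\,F(X_{N,\alpha})=\nu[F]\big(n(\ell\alpha)\Phi^t\big),$$ where $X_{N,\alpha}$ is the normalised Birkhoff sum of $\psi=\psi_{k,\ell}$.
   Context: $\mathbb{N}=\{1,2,3,\dots\}$, $e(x):=\mathrm{e}^{2\pi\mathrm{i}x}$, $\mathbb{T}=\mathbb{R}/\mathbb{Z}$, $\mathbb{T}^2=\mathbb{R}^2/\mathbb{Z}^2$. For $\alpha\in\mathbb{R}$ the skew translation is $\Lambda_\alpha:\mathbb{T}^2\to\mathbb{T}^2$, $(p,q)\mapsto(p+\alpha,q+p)$. For $k\in\mathbb{Z}$, $\ell\in\mathbb{Z}\setminus\{0\}$ let $\psi_{k,\ell}(p,q)=e(kp+\ell q)$. The Birkhoff sum is $S_{N,\alpha}[\psi]=\sum_{n=1}^N\psi\circ\Lambda_\alpha^n$. The random variable $X_{N,\alpha}$ is $$X_{N,\alpha}=\frac{S_{N,\alpha}[\psi_{k,\ell}](p,q)}{\sqrt N},$$ where $(p,q)$ is uniformly distributed in $\mathbb{T}^2$ with respect to Lebesgue measure; $\mathbb{E}$ denotes the corresponding expectation. $G=\mathrm{SL}(2,\mathbb{R})$, $\Gamma=\mathrm{SL}(2,\mathbb{Z})$,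 and $$n(u)=\begin{pmatrix}1&u\\0&1\end{pmatrix},\qquad \Phi^t=\begin{pmatrix}\mathrm{e}^{-t/2}&0\\0&\mathrm{e}^{t/2}\end{pmatrix}.$$ $C(X,Y)$ is the space of continuous functions $X\to Y$. For $g\in G$, $\nu[F](g)$ means the value of $\nu[F]$ at the coset $\Gamma g$. *)

theory Defs
  imports "HOL-Probability.Probability" "HOL-Algebra.Coset"
begin

(* The torus R/Z is represented by the fundamental domain [0,1) with addition modulo 1;
   the normalised Haar measure of the two-dimensional torus then becomes Lebesgue measure on [0,1)^2. *)

definition torus2 :: "(real \<times> real) measure" where
  "torus2 = restrict_space lborel ({0..<1} \<times> {0..<1})"

definition skew_translation :: "real \<Rightarrow> real \<times> real \<Rightarrow> real \<times> real" where
  "skew_translation \<alpha> = (\<lambda>(p, q). (frac (p + \<alpha>), frac (q + p)))"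

definition unit_exp :: "real \<Rightarrow> complex" where
  "unit_exp x = exp (2 * of_real pi * \<i> * of_real x)"

definition psi :: "int \<Rightarrow> int \<Rightarrow> real \<times> real \<Rightarrow> complex" where
  "psi k l = (\<lambda>(p, q). unit_exp (of_int k * p + of_int l * q))"

definition birkhoff_sum :: "nat \<Rightarrow> real \<Rightarrow> (real \<times> real \<Rightarrow> complex) \<Rightarrow> real \<times> real \<Rightarrow> complex" where
  "birkhoff_sum N \<alpha> f x = (\<Sum>n=1..N. f ((skew_translation \<alpha> ^^ n) x))"

definition X_rv :: "int \<Rightarrow> int \<Rightarrow> nat \<Rightarrow> real \<Rightarrow> real \<times> real \<Rightarrow> complex" where
  "X_rv k l N \<alpha> x = birkhoff_sum N \<alpha> (psi k l) x / of_real (sqrt (real N))"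

definition SL2R :: "(real^2^2) monoid" where
  "SL2R = \<lparr>carrier = {A. det A = 1}, mult = (**), one = mat 1\<rparr>"

definition SL2Z :: "(real^2^2) set" where
  "SL2Z = {A. det A = 1 \<and> (\<forall>i j. A $ i $ j \<in> \<int>)}"

definition upper_unipotent :: "real \<Rightarrow> real^2^2" where
  "upper_unipotent u = vector [vector [1, u], vector [0, 1]]"

definition geodesic_flow :: "real \<Rightarrow> real^2^2" where
  "geodesic_flow t = vector [vector [exp (- t / 2), 0], vector [0, exp (t / 2)]]"

(* The quotient topology on the space of cosets SL2Z g, where SL(2,R) carries the subspace
   topology from the space of real 2x2 matrices; in HOL-Algebra these are the right cosets. *)

definition SL2Z_quotient :: "(real^2^2) set topology" where
  "SL2Z_quotient = topology (\<lambda>U. U \<subseteq> rcosets\<^bsub>SL2R\<^esub> SL2Z \<and>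
     openin (top_of_set (carrier SL2R)) {g \<in> carrier SL2R. SL2Z #>\<^bsub>SL2R\<^esub> g \<in> U})"

lemma openin_SL2Z_quotient:
  "openin SL2Z_quotient U \<longleftrightarrow> U \<subseteq> rcosets\<^bsub>SL2R\<^esub> SL2Z \<and>
     openin (top_of_set (carrier SL2R)) {g \<in> carrier SL2R. SL2Z #>\<^bsub>SL2R\<^esub> g \<in> U}"
proof -
  let ?P = "\<lambda>U. {g \<in> carrier SL2R. SL2Z #>\<^bsub>SL2R\<^esub> g \<in> U}"
  have "istopology (\<lambda>U. U \<subseteq> rcosets\<^bsub>SL2R\<^esub> SL2Z \<and> openin (top_of_set (carrier SL2R)) (?P U))"
    unfolding istopology_def
  proof (intro conjI allI impI; (elim conjE)?)
    fix S T assume "openin (top_of_set (carrier SL2R)) (?P S)" "openin (top_of_set (carrier SL2R)) (?P T)"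
    then have "openin (top_of_set (carrier SL2R)) (?P S \<inter> ?P T)"
      by (rule openin_Int)
    moreover have "?P S \<inter> ?P T = ?P (S \<inter> T)" by blast
    ultimately show "openin (top_of_set (carrier SL2R)) (?P (S \<inter> T))" by simp
  next
    fix K assume "\<forall>S\<in>K. S \<subseteq> rcosets\<^bsub>SL2R\<^esub> SL2Z \<and> openin (top_of_set (carrier SL2R)) (?P S)"
    then have "openin (top_of_set (carrier SL2R)) (\<Union>S\<in>K. ?P S)"
      by (intro openin_Union) auto
    moreover have "(\<Union>S\<in>K. ?P S) = ?P (\<Union>K)" by blast
    ultimately show "openin (top_of_set (carrier SL2R)) (?P (\<Union>K))" by simp
  qed blast+
  then show ?thesis
    by (simp add: SL2Z_quotient_def topology_inverse')
qed

lemma topspace_SL2Z_quotient: "topspace SL2Z_quotient = rcosets\<^bsub>SL2R\<^esub> SL2Z"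
proof -
  have "{g \<in> carrier SL2R. SL2Z #>\<^bsub>SL2R\<^esub> g \<in> rcosets\<^bsub>SL2R\<^esub> SL2Z} = carrier SL2R"
    by (auto simp: RCOSETS_def)
  then have "openin SL2Z_quotient (rcosets\<^bsub>SL2R\<^esub> SL2Z)"
    by (simp add: openin_SL2Z_quotient)
  then show ?thesis
    by (meson openin_SL2Z_quotient openin_subset openin_topspace subset_antisym)
qed

lemma quotient_map_SL2Z_quotient:
  "quotient_map (top_of_set (carrier SL2R)) SL2Z_quotient (\<lambda>g. SL2Z #>\<^bsub>SL2R\<^esub> g)"
  unfolding quotient_map_def
  by (auto simp: topspace_SL2Z_quotient openin_SL2Z_quotient RCOSETS_def)

lemma group_SL2R: "group SL2R"
proof (rule groupI)
  fix A assume "A \<in> carrier SL2R"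
  then have d: "det A = 1" by (simp add: SL2R_def)
  then have "invertible A" by (simp add: invertible_det_nz)
  then obtain B where B: "B ** A = mat 1" by (auto simp: invertible_def)
  then have "det B * det A = 1" by (metis det_I det_mul)
  with d B show "\<exists>B\<in>carrier SL2R. B \<otimes>\<^bsub>SL2R\<^esub> A = \<one>\<^bsub>SL2R\<^esub>"
    by (intro bexI[of _ B]) (auto simp: SL2R_def)
qed (auto simp: SL2R_def det_mul matrix_mul_assoc)

lemma subgroup_SL2Z: "subgroup SL2Z SL2R"
proof -
  interpret group SL2R by (rule group_SL2R)
  show ?thesis
  proof (rule subgroupI)
    show "SL2Z \<subseteq> carrier SL2R" by (auto simp: SL2Z_def SL2R_def)
    have "mat 1 \<in> SL2Z" by (auto simp: SL2Z_def) (simp add: mat_def)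
    then show "SL2Z \<noteq> {}" by blast
  next
    fix A assume A: "A \<in> SL2Z"
    define B :: "real^2^2" where "B = vector [vector [A$2$2, - A$1$2], vector [- A$2$1, A$1$1]]"
    have dA: "A$1$1 * A$2$2 - A$1$2 * A$2$1 = 1"
      using A by (simp add: SL2Z_def det_2)
    have B: "B \<in> SL2Z"
      using A dA by (auto simp: SL2Z_def B_def det_2 forall_2 algebra_simps)
    have "B ** A = mat 1"
      using dA by (simp add: B_def matrix_matrix_mult_def mat_def vec_eq_iff forall_2 sum_2 algebra_simps)
    then have "inv\<^bsub>SL2R\<^esub> A = B"
      using A B by (intro inv_equality) (auto simp: SL2R_def SL2Z_def)
    with B show "inv\<^bsub>SL2R\<^esub> A \<in> SL2Z" by simp
  next
    fix A B assume AB: "A \<in> SL2Z" "B \<in> SL2Z"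
    then have "det (A ** B) = 1" by (simp add: SL2Z_def det_mul)
    moreover have "(A ** B) $ i $ j \<in> \<int>" for i j
      using AB by (auto simp: SL2Z_def matrix_matrix_mult_def intro!: Ints_sum Ints_mult)
    ultimately show "A \<otimes>\<^bsub>SL2R\<^esub> B \<in> SL2Z" by (simp add: SL2R_def SL2Z_def)
  qed
qed

lemma prob_space_torus2: "prob_space torus2"
proof
  have "{0..<1::real} \<times> {0..<1::real} \<in> sets (borel :: (real \<times> real) measure)"
    by (simp flip: borel_prod)
  then show "emeasure torus2 (space torus2) = 1"
    unfolding torus2_def
    by (simp add: emeasure_restrict_space space_restrict_space)
       (simp add: lborel_prod[symmetric] lborel.emeasure_pair_measure_Times)
qed

lemma measurable_X_rv: "X_rv k l N \<alpha> \<in> borel_measurable torus2"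
proof -
  have skew: "skew_translation \<alpha> \<in> borel_measurable borel"
    unfolding skew_translation_def frac_def case_prod_beta
    by (simp flip: borel_prod)
  have iter: "(skew_translation \<alpha> ^^ n) \<in> borel_measurable borel" for n
    by (induction n) (use skew in \<open>auto intro: measurable_comp\<close>)
  have "psi k l \<in> borel_measurable borel"
    unfolding psi_def unit_exp_def case_prod_beta
    by (intro borel_measurable_continuous_onI continuous_intros)
  then have "X_rv k l N \<alpha> \<in> borel_measurable borel"
    unfolding X_rv_def[abs_def] birkhoff_sum_def
    by (intro borel_measurable_divide borel_measurable_sum measurable_const)
       (auto intro: measurable_compose[OF iter])
  then show ?thesis
    unfolding torus2_def by (intro measurable_restrict_space1) simp
qed

end

theory Submission
  imports Defs "HOL-Complex_Analysis.Complex_Analysis"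
begin

text \<open>Averaging \<^term>\<open>F\<close> over the circle (the variable \<open>q\<close>) reduces the claim to the distribution of
  \<open>|N\<^sup>-\<^sup>1\<^sup>/\<^sup>2 \<Sum> e(u n\<^sup>2/2 + n b)|\<close> for uniform \<open>b\<close> with \<open>u = l \<alpha>\<close>. This sum is the Zak transform of
  \<open>R(g) \<chi>\<close>, where \<open>\<chi>\<close> is the indicator function of \<open>(0, 1]\<close>, \<open>g = n(u) \<Phi>\<^sup>t\<close> and \<open>R\<close> is the Weil representation.
  The mean of \<open>F\<close> over the Zak transform of \<open>R(g) f\<close> is a \<open>SL(2, Z)\<close>-invariant function of \<open>g\<close>, because the integral
  unipotents and the inversion only move the argument in the torus and change the phase. To avoid constructing \<open>R\<close>,
  we only use functions \<open>f\<close> in the span of the modulated Gaussians \<open>exp(-\<pi> x\<^sup>2) e(\<beta> x)\<close>; there \<open>R(g) f\<close>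
  is explicit, its Zak transform is a combination of Jacobi theta functions and everything is continuous in \<open>g\<close>. These functions
  approximate \<open>\<chi>\<close> in \<open>L\<^sup>2\<close>, and as \<open>R(g)\<close> and the Zak transform are isometries, the associated functions
  converge uniformly on the group; their limit is the required function.\<close>

subsection \<open>The exponential function\<close>

text \<open>Because \<open>\<chi>\<close> jumps, \<open>R(g) \<chi>\<close> in general decays only
  like \<open>1/x\<close>; its Zak series is not absolutely convergent, so the mean over it is not
  visibly continuous in \<open>g\<close>. Approximation avoids this, but the quotient of the group
  is not compact and theta functions grow in the cusp, so the error must be controlled uniformly in
  \<open>g\<close>. The \<open>L^2\<close> distance does this, being the same for every
  \<open>g\<close>. As \<open>F\<close> is only continuous and bounded, \<open>L^2\<close> closeness
  still has to be turned into closeness of means; this is the quadratic estimate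
  \<open>bounded_continuous_modulus\<close>. The formula for the Birkhoff sums is exact, not
  asymptotic: on the horocycle the image of \<open>\<chi>\<close> is a chirp cut off at
  \<open>N\<close>, whose Zak transform is a finite sum for each \<open>a\<close> in
  \<open>[0, 1)\<close>. There the variable \<open>a\<close> contributes only a phase and a
  translation of \<open>b\<close>. The phases that arise (multipliers of theta, the choice of a
  square root of the factor of automorphy) are never computed. Averaging \<open>F\<close> over the
  circle makes them harmless, as long as they have modulus 1.\<close>

definition ec :: "complex \<Rightarrow> complex" where
  "ec z = exp (2 * of_real pi * \<i> * z)"

lemma unit_exp_ec: "unit_exp x = ec (of_real x)"
  by (simp add: unit_exp_def ec_def)

lemma ec_add: "ec (z + w) = ec z * ec w"
  by (simp add: ec_def ring_distribs exp_add)

lemma ec_0 [simp]: "ec 0 = 1"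
  by (simp add: ec_def)

lemma ec_int [simp]: "ec (of_int n) = 1"
proof -
  have "2 * of_real pi * \<i> * of_int n = 2 * of_int n * of_real pi * \<i>" by simp
  then show ?thesis unfolding ec_def using exp_integer_2pi[OF Ints_of_int[of n]] by (simp add: mult_ac)
qed

lemma norm_ec: "norm (ec z) = exp (- 2 * pi * Im z)"
  by (simp add: ec_def)

lemma ec_nonzero [simp]: "ec z \<noteq> 0"
  by (simp add: ec_def)

lemma ec_add_int [simp]: "ec (z + of_int n) = ec z"
  by (simp add: ec_add)

lemma ec_eqI: "z = w + of_int n \<Longrightarrow> ec z = ec w"
  by simp

lemma holomorphic_ec [holomorphic_intros]: "f holomorphic_on S \<Longrightarrow> (\<lambda>x. ec (f x)) holomorphic_on S"
  unfolding ec_def by (intro holomorphic_intros)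

lemma continuous_ec [continuous_intros]: "continuous_on S f \<Longrightarrow> continuous_on S (\<lambda>x. ec (f x))"
  unfolding ec_def by (intro continuous_intros)

lemma continuous_unit_exp [continuous_intros]: "continuous_on S f \<Longrightarrow> continuous_on S (\<lambda>x. unit_exp (f x))"
  unfolding unit_exp_ec by (intro continuous_intros)

lemma norm_unit_exp [simp]: "norm (unit_exp x) = 1"
  by (simp add: unit_exp_ec norm_ec)

lemma unit_exp_add: "unit_exp (x + y) = unit_exp x * unit_exp y"
  by (simp add: unit_exp_ec ec_add)

lemma unit_exp_int [simp]: "unit_exp (of_int n) = 1"
  using ec_int[of n] by (simp add: unit_exp_ec del: ec_int)

lemma unit_exp_0 [simp]: "unit_exp 0 = 1"
  by (simp add: unit_exp_ec)

lemma summable_exp_abs_int: "(\<lambda>n::int. exp (- \<bar>real_of_int n\<bar>)) summable_on UNIV"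
proof -
  have nat: "(\<lambda>n::nat. exp (- real n)) summable_on UNIV"
  proof (rule norm_summable_imp_summable_on)
    have "summable (\<lambda>n::nat. exp (-1::real) ^ n)"
      by (rule summable_geometric) simp
    then show "summable (\<lambda>n::nat. norm (exp (- real n)))"
      by (simp add: exp_of_nat_mult[symmetric])
  qed
  have U: "(UNIV::int set) = range int \<union> range (\<lambda>n. - int n)"
    by (metis (no_types, lifting) UNIV_eq_I UnI1 UnI2 int_cases2 rangeI)
  show ?thesis unfolding U
  proof (rule summable_on_union)
    show "(\<lambda>n. exp (- \<bar>real_of_int n\<bar>)) summable_on range int"
      using nat by (subst summable_on_reindex) (auto simp: o_def inj_on_def)
    show "(\<lambda>n. exp (- \<bar>real_of_int n\<bar>)) summable_on range (\<lambda>n. - int n)"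
      using nat by (subst summable_on_reindex) (auto simp: o_def inj_on_def)
  qed
qed

text \<open>Completing the square in \<open>\<bar>x\<bar>\<close> absorbs the linear term; the extra
  1 in \<open>2 * pi * Y + 1\<close> pays for the factor \<open>exp (- \<bar>x\<bar>)\<close>. The
  constant depends on \<open>y\<close> and \<open>Y\<close> alone, so the bound is a majorant for a
  whole region of parameters.\<close>

lemma norm_gaussian_le:
  assumes "0 < y" "y \<le> Im \<tau>" "\<bar>Im w\<bar> \<le> Y"
  shows "norm (ec (\<tau> * of_real x ^ 2 / 2 + w * of_real x))
           \<le> exp ((2 * pi * Y + 1)\<^sup>2 / (4 * pi * y)) * exp (- \<bar>x\<bar>)"
proof -
  let ?b = "2 * pi * Y + 1" and ?u = "\<bar>x\<bar>"
  have Im: "Im (\<tau> * of_real x ^ 2 / 2 + w * of_real x) = Im \<tau> * x\<^sup>2 / 2 + Im w * x"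
    by (simp add: power2_eq_square)
  have "- (Im w * x) \<le> \<bar>Im w\<bar> * \<bar>x\<bar>"
    by (metis abs_ge_minus_self abs_mult)
  also have "\<dots> \<le> Y * \<bar>x\<bar>" using assms by (intro mult_right_mono) auto
  finally have 1: "2 * pi * (- (Im w * x)) \<le> 2 * pi * (Y * \<bar>x\<bar>)" by (intro mult_left_mono) auto
  have "y * x\<^sup>2 \<le> Im \<tau> * x\<^sup>2" using assms by (intro mult_right_mono) auto
  then have 2: "pi * (y * x\<^sup>2) \<le> pi * (Im \<tau> * x\<^sup>2)" by (intro mult_left_mono) auto
  have "0 \<le> (2 * pi * y * ?u - ?b)\<^sup>2 / (4 * pi * y)" using assms by simp
  also have "\<dots> = pi * y * ?u\<^sup>2 - ?b * ?u + ?b\<^sup>2 / (4 * pi * y)"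
    using assms by (simp add: power2_eq_square field_simps)
  finally have "?b * ?u - pi * (y * x\<^sup>2) \<le> ?b\<^sup>2 / (4 * pi * y)" by (simp add: mult.assoc)
  then have "- 2 * pi * (Im \<tau> * x\<^sup>2 / 2 + Im w * x) \<le> ?b\<^sup>2 / (4 * pi * y) - ?u"
    using 1 2 unfolding ring_distribs by (simp only: mult_ac)
  then show ?thesis
    unfolding norm_ec Im by (simp add: exp_add[symmetric])
qed

subsection \<open>The Jacobi theta function\<close>

definition theta :: "complex \<Rightarrow> complex \<Rightarrow> complex" where
  "theta \<tau> w = (\<Sum>\<^sub>\<infinity>n::int. ec (\<tau> * of_int n ^ 2 / 2 + w * of_int n))"

lemma theta_uniform_limit:
  assumes "0 < y"
  shows "uniform_limit {(\<tau>, w). y \<le> Im \<tau> \<and> \<bar>Im w\<bar> \<le> Y}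
     (\<lambda>X (\<tau>, w). \<Sum>n\<in>X. ec (\<tau> * of_int n ^ 2 / 2 + w * of_int n))
     (\<lambda>(\<tau>, w). theta \<tau> w) (finite_subsets_at_top UNIV)"
  unfolding theta_def case_prod_beta
proof (rule Weierstrass_m_test_general)
  show "(\<lambda>n::int. exp ((2 * pi * Y + 1)\<^sup>2 / (4 * pi * y)) * exp (- \<bar>real_of_int n\<bar>)) summable_on UNIV"
    by (intro summable_on_cmult_right summable_exp_abs_int)
  show "norm (ec (fst z * of_int n ^ 2 / 2 + snd z * of_int n)) \<le>
       exp ((2 * pi * Y + 1)\<^sup>2 / (4 * pi * y)) * exp (- \<bar>real_of_int n\<bar>)"
    if "z \<in> {z. y \<le> Im (fst z) \<and> \<bar>Im (snd z)\<bar> \<le> Y}" for z and n :: int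
    using norm_gaussian_le[OF assms, of "fst z" "snd z" Y "of_int n"] that by auto
qed

lemma theta_has_sum:
  assumes "0 < Im \<tau>"
  shows "((\<lambda>n::int. ec (\<tau> * of_int n ^ 2 / 2 + w * of_int n)) has_sum theta \<tau> w) UNIV"
proof -
  have "(\<lambda>n::int. norm (ec (\<tau> * of_int n ^ 2 / 2 + w * of_int n))) summable_on UNIV"
  proof (rule Infinite_Sum.abs_summable_on_comparison_test')
    show "(\<lambda>n::int. exp ((2 * pi * \<bar>Im w\<bar> + 1)\<^sup>2 / (4 * pi * Im \<tau>)) * exp (- \<bar>real_of_int n\<bar>)) summable_on UNIV"
      by (intro summable_on_cmult_right summable_exp_abs_int)
    show "norm (ec (\<tau> * of_int n ^ 2 / 2 + w * of_int n))
        \<le> exp ((2 * pi * \<bar>Im w\<bar> + 1)\<^sup>2 / (4 * pi * Im \<tau>)) * exp (- \<bar>real_of_int n\<bar>)" for n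
      using norm_gaussian_le[OF assms order_refl order_refl, of "of_int n" w] by simp
  qed
  then show ?thesis
    unfolding theta_def by (rule has_sum_infsum[OF Infinite_Sum.abs_summable_summable])
qed

lemma continuous_on_theta: "continuous_on {(\<tau>, w). 0 < Im \<tau>} (\<lambda>(\<tau>, w). theta \<tau> w)"
proof -
  let ?S = "{(\<tau>, w). 0 < Im \<tau>}"
  have "isCont (\<lambda>(\<tau>, w). theta \<tau> w) (\<tau>, w)" if "0 < Im \<tau>" for \<tau> w
  proof -
    \<comment> \<open>\<open>?V\<close> stays away from the real axis in \<open>\<tau>\<close> and
      is bounded in \<open>Im w\<close>, so the series converges uniformly on it; the open set
      \<open>?U\<close> inside it localizes continuity at the given point.\<close>
    let ?V = "{(\<tau>', w'). Im \<tau> / 2 \<le> Im \<tau>' \<and> \<bar>Im w'\<bar> \<le> \<bar>Im w\<bar> + 1}"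
    let ?U = "{(\<tau>', w'). Im \<tau> / 2 < Im \<tau>' \<and> \<bar>Im w'\<bar> < \<bar>Im w\<bar> + 1}"
    have "continuous_on ?V (\<lambda>(\<tau>, w). theta \<tau> w)"
      by (rule uniform_limit_theorem[OF _ theta_uniform_limit])
         (use that in \<open>auto simp: case_prod_beta intro!: always_eventually continuous_intros\<close>)
    then have "continuous_on ?U (\<lambda>(\<tau>, w). theta \<tau> w)"
      by (rule continuous_on_subset) auto
    moreover have "open ?U"
      unfolding case_prod_beta by (intro open_Collect_conj open_Collect_less continuous_intros)
    ultimately show ?thesis
      using that by (subst (asm) continuous_on_eq_continuous_at) auto
  qed
  then show ?thesis
    by (intro continuous_at_imp_continuous_on) auto
qed

lemma continuous_on_theta' [continuous_intros]:
  assumes "continuous_on S f" "continuous_on S g" "\<And>x. x \<in> S \<Longrightarrow> 0 < Im (f x)"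
  shows "continuous_on S (\<lambda>x. theta (f x) (g x))"
  using continuous_on_compose2[OF continuous_on_theta, of S "\<lambda>x. (f x, g x)"] assms
  by (auto intro!: continuous_on_Pair)

lemma holomorphic_theta:
  assumes "0 < Im \<tau>"
  shows "theta \<tau> holomorphic_on UNIV"
proof -
  have "theta \<tau> holomorphic_on ball z 1" for z
  proof -
    let ?f = "\<lambda>X w. \<Sum>n\<in>X. ec (\<tau> * of_int n ^ 2 / 2 + w * of_int n)"
    have lim: "uniform_limit (cball z 1) ?f (theta \<tau>) (finite_subsets_at_top UNIV)"
    proof -
      let ?T = "{(\<tau>', w). Im \<tau> \<le> Im \<tau>' \<and> \<bar>Im w\<bar> \<le> \<bar>Im z\<bar> + 1}"
      have mem: "(\<tau>, w) \<in> ?T" if "w \<in> cball z 1" for w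
        using that abs_Im_le_cmod[of "z - w"] by (auto simp: dist_norm)
      show ?thesis
        using theta_uniform_limit[OF assms, of "\<bar>Im z\<bar> + 1"] mem
        unfolding uniform_limit_iff by (force elim!: eventually_mono)
    qed
    have "continuous_on (cball z 1) (?f X) \<and> ?f X holomorphic_on ball z 1" for X :: "int set"
      by (intro conjI holomorphic_intros continuous_intros)
    then show ?thesis
      using holomorphic_uniform_limit[OF always_eventually lim] by auto
  qed
  then have "theta \<tau> field_differentiable (at z)" for z
    by (metis centre_in_ball holomorphic_on_imp_differentiable_at open_ball zero_less_one)
  then show ?thesis
    by (simp add: holomorphic_on_def field_differentiable_at_within)
qed

lemma theta_add_1: "theta \<tau> (w + 1) = theta \<tau> w"
proof -
  have "ec (\<tau> * of_int n ^ 2 / 2 + (w + 1) * of_int n) = ec (\<tau> * of_int n ^ 2 / 2 + w * of_int n)" for n :: int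
    by (rule ec_eqI[of _ _ n]) (simp add: algebra_simps)
  then show ?thesis by (simp add: theta_def)
qed

text \<open>Completing the square turns the exponent \<open>\<tau> n^2/2 + (w + \<tau>) n\<close>
  into \<open>\<tau> (n+1)^2/2 + w (n+1) - \<tau>/2 - w\<close>, and the index is shifted.\<close>

lemma theta_add_tau: "theta \<tau> (w + \<tau>) = ec (- \<tau> / 2 - w) * theta \<tau> w"
proof -
  let ?f = "\<lambda>w n. ec (\<tau> * of_int n ^ 2 / 2 + w * of_int n)"
  have "?f (w + \<tau>) n = ec (- \<tau> / 2 - w) * ?f w (n + 1)" for n :: int
    by (simp add: ec_add[symmetric]) (rule arg_cong[of _ _ ec], simp add: field_simps power2_eq_square)
  then have "theta \<tau> (w + \<tau>) = ec (- \<tau> / 2 - w) * (\<Sum>\<^sub>\<infinity>n::int. ?f w (n + 1))"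
    by (simp add: theta_def infsum_cmult_right')
  also have "(\<Sum>\<^sub>\<infinity>n::int. ?f w (n + 1)) = (\<Sum>\<^sub>\<infinity>n::int. ?f w n)"
    by (rule infsum_reindex_bij_betw[of "\<lambda>n. n + 1" UNIV UNIV "?f w"])
       (auto intro: bij_betw_byWitness[of _ "\<lambda>n. n - 1"])
  finally show ?thesis by (simp add: theta_def)
qed

subsection \<open>Integrals of periodic functions\<close>

text \<open>For an antiderivative \<open>P\<close> the difference \<open>P (x + 1) - P x\<close> is
  constant and equals the integral over one period. Hence the increment over \<open>m\<close>
  periods is \<open>m\<close> times that integral, and the substitution divides by \<open>m\<close>
  again. Negative \<open>m\<close> covers reflections.\<close>

lemma integral_periodic:
  fixes f :: "real \<Rightarrow> 'a::euclidean_space"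
  assumes cont: "continuous_on UNIV f" and per: "\<And>x. f (x + 1) = f x" and "m \<noteq> 0"
  shows "integral {0..1} (\<lambda>x. f (of_int m * x + s)) = integral {0..1} f"
proof -
  obtain P where P: "\<And>x. (P has_vector_derivative f x) (at x)"
    using einterval_antiderivative[of "-\<infinity>" "\<infinity>" f] cont
    by (auto simp: continuous_on_eq_continuous_at)
  have int: "integral {0..1} (\<lambda>x. f (r * x + z)) = (P (r + z) - P z) /\<^sub>R r" if "r \<noteq> 0" for r z :: real
  proof -
    have "((\<lambda>x. P (r * x + z) /\<^sub>R r) has_vector_derivative f (r * x + z)) (at x within {0..1})" for x
    proof -
      have "((\<lambda>x. r * x + z) has_vector_derivative r) (at x)"
        by (auto intro!: derivative_eq_intros simp: has_real_derivative_iff_has_vector_derivative[symmetric])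
      from vector_diff_chain_at[OF this P]
      have "((\<lambda>x. P (r * x + z)) has_vector_derivative r *\<^sub>R f (r * x + z)) (at x)"
        by (simp add: o_def)
      from bounded_linear.has_vector_derivative[OF bounded_linear_scaleR_right[of "inverse r"] this]
      show ?thesis using that by (simp add: has_vector_derivative_at_within)
    qed
    then have "((\<lambda>x. f (r * x + z)) has_integral (P (r * 1 + z) /\<^sub>R r - P (r * 0 + z) /\<^sub>R r)) {0..1}"
      by (intro fundamental_theorem_of_calculus) auto
    then show ?thesis
      by (simp add: integral_unique scaleR_diff_right)
  qed
  define I where "I = integral {0..1} f"
  have "((\<lambda>x. P (x + 1) - P x) has_vector_derivative 0) (at x)" for x
  proof -
    have "((\<lambda>x. x + 1) has_vector_derivative 1) (at x)"
      by (auto intro!: derivative_eq_intros simp: has_real_derivative_iff_has_vector_derivative[symmetric])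
    from has_vector_derivative_diff[OF vector_diff_chain_at[OF this P] P]
    show ?thesis by (simp add: o_def per)
  qed
  then obtain c where c: "\<And>x. P (x + 1) - P x = c"
    using has_vector_derivative_zero_constant[of UNIV "\<lambda>x. P (x + 1) - P x"] by auto
  have "c = I"
    using int[of 1 0] c[of 0] by (simp add: I_def)
  with c have step: "P (x + 1) - P x = I" for x by simp
  have "P (of_int m + s) - P s = of_int m *\<^sub>R I"
  proof (induction m rule: int_induct[of _ 0])
    case (step1 i)
    then show ?case using step[of "of_int i + s"] by (simp add: algebra_simps)
  next
    case (step2 i)
    then show ?case using step[of "of_int i - 1 + s"] by (simp add: algebra_simps)
  qed simp
  then show ?thesis
    using int[of "of_int m" s] \<open>m \<noteq> 0\<close> by (simp add: I_def)
qed

text \<open>For \<open>n \<noteq> 0\<close> a translation by half a wavelength,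
  \<open>1 / (2 * of_int n)\<close>, negates the integrand but preserves its integral.\<close>

lemma integral_unit_exp:
  "integral {0..1} (\<lambda>x. unit_exp (of_int n * x)) = (if n = 0 then 1 else 0)"
proof (cases "n = 0")
  case False
  let ?I = "integral {0..1} (\<lambda>x. unit_exp (of_int n * x))"
  have n: "unit_exp (of_int n * (x + 1)) = unit_exp (of_int n * x)" for x
    by (simp add: ring_distribs unit_exp_add)
  have "?I = integral {0..1} (\<lambda>x. unit_exp (of_int n * (of_int 1 * x + 1 / (2 * of_int n))))"
    by (rule integral_periodic[symmetric]) (auto simp: n intro!: continuous_intros)
  also have "\<dots> = integral {0..1} (\<lambda>x. - unit_exp (of_int n * x))"
  proof -
    have "unit_exp (of_int n * (of_int 1 * x + 1 / (2 * of_int n))) = unit_exp (of_int n * x) * unit_exp (1/2)" for x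
      using False by (simp add: ring_distribs unit_exp_add)
    moreover have "unit_exp (1/2) = - 1" by (simp add: unit_exp_def)
    ultimately show ?thesis by simp
  qed
  finally show ?thesis using False by simp
qed simp

lemma has_sum_integral:
  fixes u :: "'i \<Rightarrow> real \<Rightarrow> complex"
  assumes "\<And>n. continuous_on {0..1} (u n)" "\<And>n x. x \<in> {0..1} \<Longrightarrow> norm (u n x) \<le> M n" "M summable_on UNIV"
  shows "((\<lambda>n. integral {0..1} (u n)) has_sum integral {0..1} (\<lambda>x. \<Sum>\<^sub>\<infinity>n. u n x)) UNIV"
proof -
  have lim: "uniform_limit {0..1} (\<lambda>X x. \<Sum>n\<in>X. u n x) (\<lambda>x. \<Sum>\<^sub>\<infinity>n. u n x) (finite_subsets_at_top UNIV)"
    using assms by (intro Weierstrass_m_test_general) auto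
  obtain I J where I: "\<And>X. ((\<lambda>x. \<Sum>n\<in>X. u n x) has_integral I X) {0..1}"
     and J: "((\<lambda>x. \<Sum>\<^sub>\<infinity>n. u n x) has_integral J) {0..1}" "(I \<longlongrightarrow> J) (finite_subsets_at_top UNIV)"
    by (rule uniform_limit_integral[OF lim]) (auto intro!: continuous_intros assms)
  have "I X = (\<Sum>n\<in>X. integral {0..1} (u n))" if "finite X" for X
    using I[of X] integral_unique integral_sum[OF that, of u "{0..1}"] assms(1)
    by (metis integrable_continuous_interval)
  then have "((\<lambda>X. \<Sum>n\<in>X. integral {0..1} (u n)) \<longlongrightarrow> J) (finite_subsets_at_top UNIV)"
    by (intro Lim_transform_eventually[OF J(2)] eventually_finite_subsets_at_top_weakI) auto
  then show ?thesis
    using J(1) by (simp add: has_sum_def integral_unique)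
qed

subsection \<open>Trigonometric polynomials\<close>

text \<open>Finite data instead of a set of functions: \<open>wave_one\<close> turns the same list,
  with rescaled frequencies, into Gaussian packets.\<close>

definition trig :: "(complex \<times> int) list \<Rightarrow> real \<Rightarrow> complex" where
  "trig cs x = (\<Sum>(c, n)\<leftarrow>cs. c * unit_exp (of_int n * x))"

lemma trig_Nil [simp]: "trig [] x = 0"
  and trig_Cons [simp]: "trig (a # cs) x = fst a * unit_exp (of_int (snd a) * x) + trig cs x"
  by (simp_all add: trig_def case_prod_beta)

lemma trig_append: "trig (cs @ ds) x = trig cs x + trig ds x"
  by (simp add: trig_def)

lemma continuous_trig [continuous_intros]: "continuous_on S f \<Longrightarrow> continuous_on S (\<lambda>x. trig cs (f x))"
  by (induction cs) (auto intro!: continuous_intros)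

lemma trig_mult: "\<exists>es. \<forall>x. trig es x = trig cs x * trig ds x"
proof (induction cs)
  case Nil
  show ?case by (rule exI[of _ "[]"]) simp
next
  case (Cons a cs)
  then obtain es where es: "\<And>x. trig es x = trig cs x * trig ds x" by blast
  have "trig (map (\<lambda>(c, n). (fst a * c, snd a + n)) ds) x = fst a * unit_exp (of_int (snd a) * x) * trig ds x" for x
    by (induction ds) (auto simp: ring_distribs unit_exp_add)
  then show ?case
    by (intro exI[of _ "map (\<lambda>(c, n). (fst a * c, snd a + n)) ds @ es"]) (simp add: trig_append es ring_distribs)
qed

lemma trig_periodic: "trig cs (x + of_int m) = trig cs x"
proof -
  have "unit_exp (of_int n * (x + of_int m)) = unit_exp (of_int n * x)" for n
    unfolding ring_distribs unit_exp_add of_int_mult[symmetric] unit_exp_int by simp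
  then show ?thesis by (simp add: trig_def)
qed

text \<open>Equal end values let \<open>f\<close> descend along \<open>unit_exp\<close>, which is
  closed (compact to Hausdorff) and hence a quotient map onto the circle. Stone-Weierstrass applies
  there to the algebra of real functions with a complex trigonometric expansion; \<open>Re\<close>
  and \<open>Im\<close> separate points.\<close>

lemma trig_dense:
  assumes "continuous_on {0..1} f" "f 0 = f 1" "0 < e"
  obtains cs where "\<And>x. x \<in> {0..1} \<Longrightarrow> norm (of_real (f x) - trig cs x) < e"
proof -
  define F where "F z = f (Arg2pi z / (2 * pi))" for z
  have F: "F (unit_exp x) = f x" if x: "x \<in> {0..1}" for x
  proof (cases "x = 1")
    case True
    then show ?thesis using unit_exp_int[of 1] assms by (simp add: F_def Arg2pi_of_real[of 1, simplified])
  next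
    case False
    then have "Arg2pi (unit_exp x) = 2 * pi * x"
      using x by (intro Arg2pi_unique[of 1]) (auto simp: unit_exp_def mult_ac)
    then show ?thesis by (simp add: F_def)
  qed
  have surj: "unit_exp ` {0..1} = sphere 0 1"
  proof (intro equalityI subsetI)
    fix z :: complex assume "z \<in> sphere 0 1"
    then have "z = unit_exp (Arg2pi z / (2 * pi))"
      using Arg2pi_eq[of z] by (simp add: unit_exp_def mult_ac)
    then show "z \<in> unit_exp ` {0..1}"
      using Arg2pi_ge_0[of z] Arg2pi_lt_2pi[of z] by (intro image_eqI[of _ _ "Arg2pi z / (2 * pi)"]) auto
  qed auto
  have cm: "continuous_map (top_of_set {0..1}) (top_of_set (sphere 0 1)) unit_exp"
    using surj by (auto intro!: continuous_intros)
  have "quotient_map (top_of_set {0..1}) (top_of_set (sphere 0 1)) unit_exp"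
  proof (rule continuous_closed_imp_quotient_map[OF cm])
    show "closed_map (top_of_set {0..1}) (top_of_set (sphere (0::complex) 1)) unit_exp"
      by (rule continuous_imp_closed_map[OF cm]) (auto simp: compact_space_subtopology Hausdorff_space_subtopology)
  qed (use surj in simp)
  then have "continuous_map (top_of_set (sphere 0 1)) euclideanreal F"
  proof (rule continuous_compose_quotient_map)
    show "continuous_map (top_of_set {0..1}) euclideanreal (F \<circ> unit_exp)"
      using continuous_on_eq[OF assms(1), of "F \<circ> unit_exp"] F by simp
  qed
  then have contF: "continuous_on (sphere 0 1) F" by simp
  let ?P = "\<lambda>g. continuous_on (sphere 0 1) g \<and> (\<exists>cs. \<forall>x. of_real (g (unit_exp x)) = trig cs x)"
  have "\<exists>g. ?P g \<and> (\<forall>z\<in>sphere 0 1. \<bar>F z - g z\<bar> < e)"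
  proof (rule Stone_Weierstrass_HOL)
    show "?P (\<lambda>z. c)" for c
      by (auto intro!: exI[of _ "[(of_real c, 0)]"])
    show "?P (\<lambda>z. g z + h z)" if "?P g \<and> ?P h" for g h
      using that by (auto intro!: continuous_intros simp: trig_append[symmetric])
    show "?P (\<lambda>z. g z * h z)" if "?P g \<and> ?P h" for g h
      using that trig_mult by (auto intro!: continuous_intros) metis
    show "\<exists>g. ?P g \<and> g z \<noteq> g w" if "z \<in> sphere 0 1 \<and> w \<in> sphere 0 1 \<and> z \<noteq> w" for z w :: complex
    proof -
      have cnj: "cnj (unit_exp x) = unit_exp (- x)" for x
        by (simp add: unit_exp_def exp_cnj)
      have "?P Re"
        by (auto intro!: continuous_intros exI[of _ "[(1/2, 1), (1/2, -1)]"] simp: complex_eq_iff cnj[symmetric])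
      moreover have "?P Im"
        by (auto intro!: continuous_intros exI[of _ "[(-\<i>/2, 1), (\<i>/2, -1)]"] simp: complex_eq_iff cnj[symmetric])
      ultimately show ?thesis using that complex_eq_iff by blast
    qed
  qed (use contF assms in auto)
  then obtain g cs where g: "\<forall>z\<in>sphere 0 1. \<bar>F z - g z\<bar> < e" "\<And>x. of_real (g (unit_exp x)) = trig cs x"
    by blast
  have "norm (of_real (f x) - trig cs x) < e" if "x \<in> {0..1}" for x
  proof -
    have "norm (of_real (f x) - trig cs x) = \<bar>F (unit_exp x) - g (unit_exp x)\<bar>"
      unfolding F[OF that] g(2)[symmetric] by (simp flip: of_real_diff)
    also have "\<dots> < e" using g(1) by auto
    finally show ?thesis .
  qed
  with that show thesis by blast
qed

text \<open>By density of trigonometric polynomials \<open>d\<close> is orthogonal to every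
  continuous real \<open>r\<close> with equal end values. Taking \<open>r\<close> to be the real and
  the imaginary part of \<open>d\<close> makes the integrals of their squares vanish.\<close>

lemma fourier_coefficients_zero:
  fixes d :: "real \<Rightarrow> complex"
  assumes cont: "continuous_on {0..1} d" and "d 0 = d 1"
    and zero: "\<And>n. integral {0..1} (\<lambda>x. d x * unit_exp (of_int n * x)) = 0" and "x \<in> {0..1}"
  shows "d x = 0"
proof -
  have trig: "integral {0..1} (\<lambda>x. d x * trig cs x) = 0" for cs
  proof (induction cs)
    case (Cons a cs)
    have "integral {0..1} (\<lambda>x. d x * trig (a # cs) x)
        = integral {0..1} (\<lambda>x. fst a * (d x * unit_exp (of_int (snd a) * x)) + d x * trig cs x)"
      by (simp add: algebra_simps)
    also have "\<dots> = integral {0..1} (\<lambda>x. fst a * (d x * unit_exp (of_int (snd a) * x))) + integral {0..1} (\<lambda>x. d x * trig cs x)"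
      by (intro integral_add integrable_continuous_interval continuous_intros cont)
    finally show ?case using Cons zero by simp
  qed simp
  obtain M where M: "\<And>x. x \<in> {0..1} \<Longrightarrow> norm (d x) \<le> M" "M > 0"
    using compact_imp_bounded[OF compact_continuous_image[OF cont compact_Icc]]
    unfolding bounded_pos by blast
  have orth: "integral {0..1} (\<lambda>x. d x * of_real (r x)) = 0"
    if r: "continuous_on {0..1} r" "r 0 = r 1" for r
  proof -
    have "norm (integral {0..1} (\<lambda>x. d x * of_real (r x))) \<le> e" if e: "e > 0" for e
    proof -
      obtain cs where cs: "\<And>x. x \<in> {0..1} \<Longrightarrow> norm (of_real (r x) - trig cs x) < e / M"
        by (rule trig_dense[OF r, of "e / M"]) (use M(2) e in auto)
      have "integral {0..1} (\<lambda>x. d x * of_real (r x))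
         = integral {0..1} (\<lambda>x. d x * of_real (r x)) - integral {0..1} (\<lambda>x. d x * trig cs x)"
        using trig by simp
      also have "\<dots> = integral {0..1} (\<lambda>x. d x * (of_real (r x) - trig cs x))"
        unfolding right_diff_distrib
        by (intro integral_diff[symmetric] integrable_continuous_interval continuous_intros cont r)
      also have "norm \<dots> \<le> e * (1 - 0)"
      proof (rule integral_bound)
        show "continuous_on {0..1} (\<lambda>x. d x * (of_real (r x) - trig cs x))"
          by (intro continuous_intros cont r)
        fix x :: real assume x: "x \<in> {0..1}"
        have "norm (d x * (of_real (r x) - trig cs x)) \<le> M * (e / M)"
          unfolding norm_mult using M x cs[OF x] by (intro mult_mono) auto
        then show "norm (d x * (of_real (r x) - trig cs x)) \<le> e" using M by simp
      qed simp
      finally show ?thesis by simp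
    qed
    then have "norm (integral {0..1} (\<lambda>x. d x * of_real (r x))) \<le> 0" by (rule dense_ge)
    then show ?thesis by simp
  qed
  have sq: "r x = 0" if r: "continuous_on {0..1} r" "integral {0..1} (\<lambda>x. r x * r x) = 0" for r :: "real \<Rightarrow> real"
  proof -
    have "continuous_on {0..1} (\<lambda>x. r x * r x)" by (intro continuous_intros r)
    from integral_eq_0_iff[OF this] have "\<forall>x\<in>{0..1}. r x * r x = 0" using r(2) by simp
    then show ?thesis using \<open>x \<in> {0..1}\<close> by simp
  qed
  have int: "(\<lambda>x. d x * of_real (r x)) integrable_on {0..1}" if "continuous_on {0..1} r" for r
    by (intro integrable_continuous_interval continuous_intros cont that)
  have cont_Re: "continuous_on {0..1} (\<lambda>x. Re (d x))" and cont_Im: "continuous_on {0..1} (\<lambda>x. Im (d x))"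
    by (intro continuous_intros cont)+
  have "integral {0..1} (\<lambda>x. Re (d x) * Re (d x)) = Re (integral {0..1} (\<lambda>x. d x * of_real (Re (d x))))"
    using integral_linear[OF int[OF cont_Re] bounded_linear_Re] by (simp add: o_def)
  then have "Re (d x) = 0"
    by (intro sq[OF cont_Re]) (simp add: orth[OF cont_Re] \<open>d 0 = d 1\<close>)
  moreover have "integral {0..1} (\<lambda>x. Im (d x) * Im (d x)) = Im (integral {0..1} (\<lambda>x. d x * of_real (Im (d x))))"
    using integral_linear[OF int[OF cont_Im] bounded_linear_Im] by (simp add: o_def)
  then have "Im (d x) = 0"
    by (intro sq[OF cont_Im]) (simp add: orth[OF cont_Im] \<open>d 0 = d 1\<close>)
  ultimately show ?thesis by (simp add: complex_eq_iff)
qed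

subsection \<open>The inversion formula for theta\<close>

text \<open>A contour shift without contours: for a primitive \<open>P\<close> the difference
  \<open>P (w + 1) - P w\<close> has derivative zero by periodicity, and it is the integral along
  the horizontal unit segment starting at any complex point.\<close>

lemma entire_periodic_integral:
  assumes hol: "k holomorphic_on UNIV" and per: "\<And>w. k (w + 1) = k w"
  shows "integral {0..1} (\<lambda>x. k (of_real x + z)) = integral {0..1} (\<lambda>x. k (of_real x))"
proof -
  obtain P where P: "\<And>w. (P has_field_derivative k w) (at w)"
    using holomorphic_convex_primitive'[OF convex_UNIV open_UNIV hol] by auto
  have "((\<lambda>w. P (w + 1) - P w) has_field_derivative 0) (at w)" for w
  proof -
    have "((\<lambda>w. P (w + 1)) has_field_derivative k (w + 1)) (at w)"
      using P[of "w + 1"] DERIV_shift[of P _ w 1] by blast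
    from DERIV_diff[OF this P] show ?thesis by (simp add: per)
  qed
  then obtain c where c: "\<And>w. P (w + 1) - P w = c"
    using has_field_derivative_zero_constant[of UNIV "\<lambda>w. P (w + 1) - P w"] by auto
  have int: "integral {0..1} (\<lambda>x. k (of_real x + z)) = c" for z
  proof -
    have "((\<lambda>x. P (of_real x + z)) has_vector_derivative k (of_real x + z)) (at x within {0..1})" for x
    proof -
      have "((\<lambda>w. P (w + z)) has_field_derivative k (of_real x + z)) (at (of_real x))"
        using P[of "of_real x + z"] DERIV_shift[of P _ "of_real x" z] by blast
      then show ?thesis by (rule has_vector_derivative_at_within[OF has_vector_derivative_real_field])
    qed
    then have "((\<lambda>x. k (of_real x + z)) has_integral P (of_real 1 + z) - P (of_real 0 + z)) {0..1}"
      by (intro fundamental_theorem_of_calculus) auto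
    then show ?thesis using c[of z] by (simp add: integral_unique add.commute)
  qed
  show ?thesis using int[of z] int[of 0] by simp
qed

text \<open>The Fourier coefficients of a function with the quasi-periodicity of theta satisfy a first order
  recursion, so they all vanish as soon as the zeroth one does.\<close>

lemma quasi_periodic_eq_zero:
  assumes hol: "d holomorphic_on UNIV" and per: "\<And>w. d (w + 1) = d w"
    and quasi: "\<And>w. d (w + \<tau>) = ec (- \<tau> / 2 - w) * d w"
    and zero: "integral {0..1} (\<lambda>x. d (of_real x)) = 0"
  shows "d w = 0"
proof -
  define a where "a n = integral {0..1} (\<lambda>x. d (of_real x) * ec (of_int n * of_real x))" for n
  \<comment> \<open>Moving the segment by \<open>\<tau>\<close> does not change the integral, while
    quasi-periodicity produces a constant factor and lowers the frequency by one.\<close>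
  have rec: "a n = ec ((of_int n - 1/2) * \<tau>) * a (n - 1)" for n
  proof -
    let ?k = "\<lambda>w. d w * ec (of_int n * w)"
    have "a n = integral {0..1} (\<lambda>x. ?k (of_real x + \<tau>))"
      unfolding a_def
      by (rule entire_periodic_integral[symmetric])
         (auto intro!: holomorphic_intros hol simp: per ring_distribs)
    also have "(\<lambda>x. ?k (of_real x + \<tau>)) =
        (\<lambda>x. ec ((of_int n - 1/2) * \<tau>) * (d (of_real x) * ec (of_int (n - 1) * of_real x)))"
    proof
      fix x
      have "ec (- \<tau> / 2 - of_real x) * ec (of_int n * (of_real x + \<tau>))
          = ec ((of_int n - 1/2) * \<tau>) * ec (of_int (n - 1) * of_real x)"
        unfolding ec_add[symmetric] by (rule arg_cong[of _ _ ec]) (simp add: algebra_simps)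
      then show "?k (of_real x + \<tau>) = ec ((of_int n - 1/2) * \<tau>) * (d (of_real x) * ec (of_int (n - 1) * of_real x))"
        unfolding quasi by (metis (no_types, lifting) mult.assoc mult.left_commute)
    qed
    finally show ?thesis by (simp add: a_def)
  qed
  have a: "a n = 0" for n
  proof (induction n rule: int_induct[of _ 0])
    case base
    then show ?case using zero by (simp add: a_def)
  next
    case (step1 i)
    then show ?case using rec[of "i + 1"] by simp
  next
    case (step2 i)
    then show ?case using rec[of i] by simp
  qed
  have cont: "continuous_on UNIV d" using hol by (rule holomorphic_on_imp_continuous_on)
  have real: "d (of_real x) = 0" if "x \<in> {0..1}" for x
  proof (rule fourier_coefficients_zero[of "\<lambda>x. d (of_real x)", OF _ _ _ that])
    show "continuous_on {0..1} (\<lambda>x. d (of_real x))"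
      by (intro continuous_on_compose2[OF cont] continuous_intros) auto
    show "d (of_real 0) = d (of_real 1)" using per[of 0] by simp
    show "integral {0..1} (\<lambda>x. d (of_real x) * unit_exp (of_int n * x)) = 0" for n
      using a[of n] by (simp add: a_def unit_exp_ec)
  qed
  show ?thesis
  proof (rule analytic_continuation[of d UNIV "of_real ` {0..1}" 0])
    show "0 islimpt complex_of_real ` {0..1}"
      unfolding islimpt_sequential
    proof (intro exI conjI allI)
      fix n
      have "inverse (real (Suc n)) \<in> {0..1}" by (auto simp: inverse_le_1_iff)
      then show "complex_of_real (inverse (real (Suc n))) \<in> of_real ` {0..1} - {0}"
        by (intro DiffI imageI) (auto simp del: of_real_inverse)
      show "(\<lambda>n. complex_of_real (inverse (real (Suc n)))) \<longlonglongrightarrow> 0"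
        using tendsto_of_real[OF LIMSEQ_inverse_real_of_nat, where 'a = complex] by simp
    qed
  qed (use hol real in auto)
qed

lemma theta_integral: "0 < Im \<tau> \<Longrightarrow> integral {0..1} (\<lambda>x. theta \<tau> (of_real x)) = 1"
proof -
  assume \<tau>: "0 < Im \<tau>"
  let ?u = "\<lambda>n::int. \<lambda>x::real. ec (\<tau> * of_int n ^ 2 / 2 + of_real x * of_int n)"
  have "((\<lambda>n. integral {0..1} (?u n)) has_sum integral {0..1} (\<lambda>x. theta \<tau> (of_real x))) UNIV"
    unfolding theta_def
  proof (rule has_sum_integral)
    show "norm (?u n x) \<le> exp ((2 * pi * 0 + 1)\<^sup>2 / (4 * pi * Im \<tau>)) * exp (- \<bar>real_of_int n\<bar>)" for n x
      using norm_gaussian_le[OF \<tau> order_refl, of "of_real x" 0 "of_int n"] by simp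
  qed (intro continuous_intros summable_on_cmult_right summable_exp_abs_int)+
  moreover have "integral {0..1} (?u n) = (if n = 0 then 1 else 0)" for n
  proof -
    have "?u n = (\<lambda>x. ec (\<tau> * of_int n ^ 2 / 2) * unit_exp (of_int n * x))"
      by (auto simp: ec_add unit_exp_ec mult.commute)
    then show ?thesis by (simp add: integral_unit_exp)
  qed
  ultimately have "((\<lambda>n::int. if n = 0 then 1 else 0) has_sum integral {0..1} (\<lambda>x. theta \<tau> (of_real x))) UNIV"
    by simp
  moreover have "((\<lambda>n::int. if n = 0 then 1 else 0) has_sum (1::complex)) UNIV"
    using has_sum_finite_neutralI[of "{0}" UNIV "\<lambda>n::int. if n = 0 then 1 else (0::complex)"] by simp
  ultimately show ?thesis by (rule has_sum_unique)
qed

text \<open>Both sides are entire with the same two functional equations: passing to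
  \<open>- 1 / \<tau>\<close> exchanges the period and the quasi-period of theta. By uniqueness they
  are proportional. The constant stays unspecified; its modulus is determined later through
  \<open>L^2\<close> norms.\<close>

lemma theta_inversion:
  assumes \<tau>: "0 < Im \<tau>"
  obtains c where "\<And>w. ec (- w\<^sup>2 / (2 * \<tau>)) * theta (- 1 / \<tau>) (w / \<tau>) = c * theta \<tau> w"
proof -
  have nz: "\<tau> \<noteq> 0" using \<tau> by auto
  have \<tau>': "0 < Im (- 1 / \<tau>)"
    using \<tau> by (auto simp: Im_divide sum_power2_gt_zero_iff intro!: divide_pos_pos)
  define h where "h w = ec (- w\<^sup>2 / (2 * \<tau>)) * theta (- 1 / \<tau>) (w / \<tau>)" for w
  have holtheta: "(\<lambda>w. theta \<sigma> (f w)) holomorphic_on UNIV" if "0 < Im \<sigma>" "f holomorphic_on UNIV" for \<sigma> f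
    using holomorphic_on_compose[OF that(2), of "theta \<sigma>"] holomorphic_theta[OF that(1)]
    by (auto simp: o_def intro: holomorphic_on_subset)
  have holh: "h holomorphic_on UNIV"
    unfolding h_def by (intro holomorphic_intros holtheta \<tau>') (use nz in auto)
  have perh: "h (w + 1) = h w" for w
  proof -
    \<comment> \<open>Quasi-periodicity for the modulus \<open>- 1 / \<tau>\<close>, applied at
      \<open>(w + 1) / \<tau>\<close>: adding \<open>- 1 / \<tau>\<close> leads back to
      \<open>w / \<tau>\<close>.\<close>
    have "theta (- 1 / \<tau>) (w / \<tau>) = ec (1 / (2 * \<tau>) - (w + 1) / \<tau>) * theta (- 1 / \<tau>) ((w + 1) / \<tau>)"
      using theta_add_tau[of "- 1 / \<tau>" "(w + 1) / \<tau>"] by (simp add: add_divide_distrib)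
    then have "h w = (ec (- w\<^sup>2 / (2 * \<tau>)) * ec (1 / (2 * \<tau>) - (w + 1) / \<tau>)) * theta (- 1 / \<tau>) ((w + 1) / \<tau>)"
      by (simp add: h_def)
    also have "- w\<^sup>2 / (2 * \<tau>) + (1 / (2 * \<tau>) - (w + 1) / \<tau>) = - (w + 1)\<^sup>2 / (2 * \<tau>)"
      using nz by (simp add: field_simps power2_eq_square)
    then have "ec (- w\<^sup>2 / (2 * \<tau>)) * ec (1 / (2 * \<tau>) - (w + 1) / \<tau>) = ec (- (w + 1)\<^sup>2 / (2 * \<tau>))"
      by (simp only: ec_add[symmetric])
    finally show ?thesis by (simp add: h_def)
  qed
  have quasih: "h (w + \<tau>) = ec (- \<tau> / 2 - w) * h w" for w
  proof -
    have "theta (- 1 / \<tau>) ((w + \<tau>) / \<tau>) = theta (- 1 / \<tau>) (w / \<tau>)"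
      using theta_add_1[of "- 1 / \<tau>" "w / \<tau>"] nz by (simp add: add_divide_distrib)
    moreover have "- (w + \<tau>)\<^sup>2 / (2 * \<tau>) = (- \<tau> / 2 - w) + - w\<^sup>2 / (2 * \<tau>)"
      using nz by (simp add: field_simps power2_eq_square)
    then have "ec (- (w + \<tau>)\<^sup>2 / (2 * \<tau>)) = ec (- \<tau> / 2 - w) * ec (- w\<^sup>2 / (2 * \<tau>))"
      by (simp only: ec_add)
    ultimately show ?thesis by (simp add: h_def)
  qed
  \<comment> \<open>Theta has mean 1 over a period, so subtracting \<open>c\<close> times theta
    removes the zeroth Fourier coefficient of \<open>h\<close>.\<close>
  define c where "c = integral {0..1} (\<lambda>x. h (of_real x))"
  have "h w - c * theta \<tau> w = 0" for w
  proof (rule quasi_periodic_eq_zero[where d = "\<lambda>w. h w - c * theta \<tau> w" and \<tau> = \<tau>])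
    show "(\<lambda>w. h w - c * theta \<tau> w) holomorphic_on UNIV"
      by (intro holomorphic_intros holh holomorphic_theta \<tau>)
    show "h (w + 1) - c * theta \<tau> (w + 1) = h w - c * theta \<tau> w" for w
      by (simp add: perh theta_add_1)
    show "h (w + \<tau>) - c * theta \<tau> (w + \<tau>) = ec (- \<tau> / 2 - w) * (h w - c * theta \<tau> w)" for w
      unfolding quasih theta_add_tau by (simp add: right_diff_distrib)
    have cont: "continuous_on {0..1} (\<lambda>x. f (complex_of_real x))" if "f holomorphic_on UNIV" for f
      by (intro continuous_on_compose2[OF holomorphic_on_imp_continuous_on[OF that]] continuous_intros) auto
    have "integral {0..1} (\<lambda>x. h (of_real x) - c * theta \<tau> (of_real x)) =
       integral {0..1} (\<lambda>x. h (of_real x)) - integral {0..1} (\<lambda>x. c * theta \<tau> (of_real x))"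
      by (intro integral_diff integrable_continuous_interval continuous_on_mult continuous_on_const cont holh holomorphic_theta \<tau>)
    then show "integral {0..1} (\<lambda>x. h (of_real x) - c * theta \<tau> (of_real x)) = 0"
      by (simp add: c_def theta_integral[OF \<tau>])
  qed
  then show thesis
    by (intro that[of c]) (simp add: h_def)
qed

subsection \<open>Parseval's identity\<close>

lemma summable_norm_bounded:
  fixes A :: "'i \<Rightarrow> complex"
  assumes "(\<lambda>n. norm (A n)) summable_on UNIV" "\<And>n. norm (u n) \<le> 1"
  shows "(\<lambda>n. A n * u n) summable_on UNIV" "norm (\<Sum>\<^sub>\<infinity>n. A n * u n) \<le> (\<Sum>\<^sub>\<infinity>n. norm (A n))"
proof -
  have le: "norm (A n * u n) \<le> norm (A n)" for n
    using assms(2)[of n] by (simp add: norm_mult mult_left_le)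
  have s: "(\<lambda>n. norm (A n * u n)) summable_on UNIV"
    by (rule Infinite_Sum.abs_summable_on_comparison_test'[OF assms(1) le])
  then show "(\<lambda>n. A n * u n) summable_on UNIV" by (rule Infinite_Sum.abs_summable_summable)
  have "norm (\<Sum>\<^sub>\<infinity>n. A n * u n) \<le> (\<Sum>\<^sub>\<infinity>n. norm (A n * u n))" by (rule norm_infsum_bound[OF s])
  also have "\<dots> \<le> (\<Sum>\<^sub>\<infinity>n. norm (A n))" by (intro infsum_mono s assms(1) le)
  finally show "norm (\<Sum>\<^sub>\<infinity>n. A n * u n) \<le> (\<Sum>\<^sub>\<infinity>n. norm (A n))" .
qed

lemma continuous_fourier_series:
  fixes A :: "int \<Rightarrow> complex"
  assumes "(\<lambda>n. norm (A n)) summable_on UNIV"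
  shows "continuous_on UNIV (\<lambda>b. \<Sum>\<^sub>\<infinity>n. A n * unit_exp (of_int n * b))"
  by (rule uniform_limit_theorem[OF _ Weierstrass_m_test_general[OF _ assms]])
     (auto simp: norm_mult intro!: always_eventually continuous_intros)

lemma parseval:
  fixes A :: "int \<Rightarrow> complex"
  assumes A: "(\<lambda>n. norm (A n)) summable_on UNIV"
  shows "((\<lambda>n. (norm (A n))\<^sup>2) has_sum
      integral {0..1} (\<lambda>b. (norm (\<Sum>\<^sub>\<infinity>n. A n * unit_exp (of_int n * b)))\<^sup>2)) UNIV"
proof -
  define S where "S b = (\<Sum>\<^sub>\<infinity>n. A n * unit_exp (of_int n * b))" for b
  have contS: "continuous_on X S" for X
    using continuous_fourier_series[OF A] unfolding S_def by (rule continuous_on_subset) simp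
  define K where "K = (\<Sum>\<^sub>\<infinity>n. norm (A n))"
  have K: "norm (S b) \<le> K" for b
    unfolding S_def K_def by (rule summable_norm_bounded(2)[OF A]) simp
  have coeff: "integral {0..1} (\<lambda>b. unit_exp (of_int (- m) * b) * S b) = A m" for m
  proof -
    let ?u = "\<lambda>n b. A n * unit_exp (of_int (n - m) * b)"
    have "((\<lambda>n. integral {0..1} (?u n)) has_sum integral {0..1} (\<lambda>b. \<Sum>\<^sub>\<infinity>n. ?u n b)) UNIV"
      by (rule has_sum_integral[OF _ _ A]) (auto simp: norm_mult intro!: continuous_intros)
    also have "(\<lambda>n. integral {0..1} (?u n)) = (\<lambda>n. if n = m then A m else 0)"
      using integral_unit_exp[of "_ - m"] by (auto simp del: of_int_diff)
    also have "(\<lambda>b. \<Sum>\<^sub>\<infinity>n. ?u n b) = (\<lambda>b. unit_exp (of_int (- m) * b) * S b)"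
    proof
      fix b
      have "?u n b = unit_exp (of_int (- m) * b) * (A n * unit_exp (of_int n * b))" for n
      proof -
        have "of_int (n - m) * b = of_int (- m) * b + of_int n * b" by (simp add: algebra_simps)
        then show ?thesis by (simp only: unit_exp_add mult_ac)
      qed
      then show "(\<Sum>\<^sub>\<infinity>n. ?u n b) = unit_exp (of_int (- m) * b) * S b"
        by (simp only: S_def infsum_cmult_right')
    qed
    finally have "((\<lambda>n. if n = m then A m else 0) has_sum
       integral {0..1} (\<lambda>b. unit_exp (of_int (- m) * b) * S b)) UNIV" .
    moreover have "((\<lambda>n. if n = m then A m else 0) has_sum A m) UNIV"
      using has_sum_finite_neutralI[of "{m}" UNIV "\<lambda>n. if n = m then A m else 0"] by simp
    ultimately show ?thesis by (rule has_sum_unique)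
  qed
  \<comment> \<open>The conjugate factor of \<open>\<bar>S\<bar>^2\<close> is expanded into its
    series and integrated term by term; the other factor \<open>S b\<close> is kept whole and
    bounded by \<open>K\<close>.\<close>
  let ?v = "\<lambda>m b. cnj (A m) * (unit_exp (of_int (- m) * b) * S b)"
  have "((\<lambda>m. integral {0..1} (?v m)) has_sum integral {0..1} (\<lambda>b. \<Sum>\<^sub>\<infinity>m. ?v m b)) UNIV"
  proof (rule has_sum_integral)
    show "(\<lambda>m. norm (A m) * K) summable_on UNIV" by (intro summable_on_cmult_left A)
    show "norm (?v m b) \<le> norm (A m) * K" for m b
      using K[of b] by (simp add: norm_mult mult_left_mono)
  qed (intro continuous_intros contS)
  also have "(\<lambda>m. integral {0..1} (?v m)) = (\<lambda>m. of_real ((norm (A m))\<^sup>2))"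
    using coeff by (simp add: complex_norm_square mult.commute del: of_real_power)
  also have "(\<lambda>b. \<Sum>\<^sub>\<infinity>m. ?v m b) = (\<lambda>b. of_real ((norm (S b))\<^sup>2))"
  proof
    fix b
    have cnj: "cnj (unit_exp x) = unit_exp (- x)" for x
      by (simp add: unit_exp_def exp_cnj)
    have "(\<Sum>\<^sub>\<infinity>m. ?v m b) = (\<Sum>\<^sub>\<infinity>m. cnj (A m * unit_exp (of_int m * b)) * S b)"
      by (simp add: cnj mult_ac)
    also have "\<dots> = cnj (S b) * S b"
      by (simp only: infsum_cmult_left' infsum_cnj S_def)
    finally show "(\<Sum>\<^sub>\<infinity>m. ?v m b) = of_real ((norm (S b))\<^sup>2)"
      by (simp add: complex_norm_square mult.commute del: of_real_power)
  qed
  finally have "((\<lambda>m. of_real ((norm (A m))\<^sup>2)) has_sum integral {0..1} (\<lambda>b. complex_of_real ((norm (S b))\<^sup>2))) UNIV" .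
  from has_sum_Re[OF this]
  have "((\<lambda>m. (norm (A m))\<^sup>2) has_sum Re (integral {0..1} (\<lambda>b. complex_of_real ((norm (S b))\<^sup>2)))) UNIV"
    by (simp del: of_real_power)
  also have "Re (integral {0..1} (\<lambda>b. complex_of_real ((norm (S b))\<^sup>2))) = integral {0..1} (\<lambda>b. (norm (S b))\<^sup>2)"
    using integral_linear[OF _ bounded_linear_Re, of "\<lambda>b. complex_of_real ((norm (S b))\<^sup>2)" "{0..1}"]
    by (simp add: o_def integrable_continuous_interval continuous_on_of_real continuous_on_norm continuous_on_power contS del: of_real_power)
  finally show ?thesis by (simp add: S_def)
qed

subsection \<open>The Zak transform\<close>

definition zak :: "(real \<Rightarrow> complex) \<Rightarrow> real \<Rightarrow> real \<Rightarrow> complex" where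
  "zak f a b = (\<Sum>\<^sub>\<infinity>n. f (of_int n - a) * unit_exp (of_int n * b))"

definition torus_integral :: "(real \<times> real \<Rightarrow> real) \<Rightarrow> real" where
  "torus_integral f = integral (cbox (0, 0) (1, 1)) f"

lemma summable_translates:
  fixes f :: "real \<Rightarrow> complex"
  assumes "\<And>x. norm (f x) \<le> K * exp (- \<bar>x\<bar>)"
  shows "(\<lambda>n::int. norm (f (of_int n - a))) summable_on UNIV"
proof (rule Infinite_Sum.abs_summable_on_comparison_test')
  show "(\<lambda>n::int. K * exp \<bar>a\<bar> * exp (- \<bar>real_of_int n\<bar>)) summable_on UNIV"
    by (intro summable_on_cmult_right summable_exp_abs_int)
  have K: "0 \<le> K" using order_trans[OF norm_ge_zero assms[of 0]] by simp
  fix n :: int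
  have "norm (f (of_int n - a)) \<le> K * exp (- \<bar>of_int n - a\<bar>)" by (rule assms)
  also have "\<dots> \<le> K * exp (\<bar>a\<bar> - \<bar>real_of_int n\<bar>)"
    using K by (intro mult_left_mono) auto
  finally show "norm (f (of_int n - a)) \<le> K * exp \<bar>a\<bar> * exp (- \<bar>real_of_int n\<bar>)"
    by (simp add: exp_diff exp_minus divide_inverse)
qed

text \<open>As \<open>a\<close> runs through \<open>[0, 1)\<close>, the point \<open>z - a\<close>
  runs through \<open>(z - 1, z]\<close>, and these intervals tile the line; the tile containing
  \<open>x\<close> is the one with \<open>z = \<lceil>x\<rceil>\<close>. The integers are enumerated
  by \<open>int_decode\<close> so that monotone convergence for series applies.\<close>

lemma nn_integral_fold:
  fixes f :: "real \<Rightarrow> ennreal"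
  assumes f [measurable]: "f \<in> borel_measurable borel"
  shows "(\<integral>\<^sup>+a. (\<Sum>i. f (of_int (int_decode i) - a)) * indicator {0..<1} a \<partial>lborel) = (\<integral>\<^sup>+x. f x \<partial>lborel)"
proof -
  let ?z = "\<lambda>i. real_of_int (int_decode i)"
  let ?B = "\<lambda>i. {?z i - 1<..?z i}"
  have "(\<integral>\<^sup>+a. (\<Sum>i. f (?z i - a)) * indicator {0..<1} a \<partial>lborel)
      = (\<integral>\<^sup>+a. (\<Sum>i. f (?z i - a) * indicator {0..<1} a) \<partial>lborel)"
    by simp
  also have "\<dots> = (\<Sum>i. \<integral>\<^sup>+a. f (?z i - a) * indicator {0..<1} a \<partial>lborel)"
    by (rule nn_integral_suminf) measurable
  also have "\<dots> = (\<Sum>i. \<integral>\<^sup>+x. f x * indicator (?B i) x \<partial>lborel)"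
  proof -
    have "(\<integral>\<^sup>+x. f x * indicator (?B i) x \<partial>lborel) = (\<integral>\<^sup>+a. f (?z i - a) * indicator {0..<1} a \<partial>lborel)" for i
    proof -
      have ind: "indicator (?B i) (?z i - a) = (indicator {0..<1} a :: ennreal)" for a
        by (auto simp: indicator_def)
      show ?thesis
        by (subst nn_integral_real_affine[where c = "-1" and t = "?z i"]) (simp_all add: ind)
    qed
    then show ?thesis by simp
  qed
  also have "\<dots> = (\<integral>\<^sup>+x. (\<Sum>i. f x * indicator (?B i) x) \<partial>lborel)"
    by (rule nn_integral_suminf[symmetric]) measurable
  also have "\<dots> = (\<integral>\<^sup>+x. f x \<partial>lborel)"
  proof (rule nn_integral_cong)
    fix x :: real
    have "(\<Sum>i. f x * indicator (?B i) x) = (\<Sum>i\<in>{int_encode \<lceil>x\<rceil>}. f x * indicator (?B i) x)"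
    proof (rule suminf_finite)
      fix i assume "i \<notin> {int_encode \<lceil>x\<rceil>}"
      then have "int_decode i \<noteq> \<lceil>x\<rceil>" by (metis int_decode_inverse singletonI)
      then have "x \<notin> ?B i" using ceiling_unique[of "int_decode i" x] by auto
      then show "f x * indicator (?B i) x = 0" by simp
    qed simp
    also have "x \<in> ?B (int_encode \<lceil>x\<rceil>)" by (auto, linarith)
    then have "(\<Sum>i\<in>{int_encode \<lceil>x\<rceil>}. f x * indicator (?B i) x) = f x" by simp
    finally show "(\<Sum>i. f x * indicator (?B i) x) = f x" .
  qed
  finally show ?thesis .
qed

section \<open>Transformations of the unit torus\<close>

lemma torus_integral_iterated:
  assumes "continuous_on (cbox (0, 0) (1, 1)) f"
  shows "torus_integral f = integral {0..1} (\<lambda>a. integral {0..1} (\<lambda>b. f (a, b)))"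
  unfolding torus_integral_def using integral_prod_continuous[OF assms] by simp

lemma torus_integral_swap:
  assumes "continuous_on UNIV f"
  shows "torus_integral (\<lambda>(a, b). f (b, a)) = torus_integral f"
proof -
  have c: "continuous_on X (\<lambda>(a, b). f (a, b))" "continuous_on X (\<lambda>(a, b). f (b, a))" for X
    by (auto simp: case_prod_beta intro!: continuous_intros continuous_on_compose2[OF assms])
  have "integral {0..1} (\<lambda>a. integral {0..1} (\<lambda>b. f (a, b))) = integral {0..1} (\<lambda>a. integral {0..1} (\<lambda>b. f (b, a)))"
    using integral_swap_continuous[of 0 0 1 1 "\<lambda>a b. f (a, b)", OF c(1)] by simp
  then show ?thesis
    using torus_integral_iterated[OF c(2)] torus_integral_iterated[of f, OF continuous_on_subset[OF assms]]
    by simp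
qed

lemma torus_integral_shear:
  assumes f: "continuous_on UNIV f" and per: "\<And>a b. f (a, b + 1) = f (a, b)" and s: "continuous_on UNIV s"
  shows "torus_integral (\<lambda>(a, b). f (a, b + s a)) = torus_integral f"
proof -
  have c: "continuous_on X (\<lambda>(a, b). f (a, b + s a))" for X
    by (auto simp: case_prod_beta intro!: continuous_intros continuous_on_compose2[OF f] continuous_on_compose2[OF s])
  have "integral {0..1} (\<lambda>b. f (a, b + s a)) = integral {0..1} (\<lambda>b. f (a, b))" for a
    using integral_periodic[of "\<lambda>b. f (a, b)" 1 "s a", OF continuous_on_compose2[OF f]] per
    by (simp add: continuous_intros)
  then show ?thesis
    using torus_integral_iterated[OF c] torus_integral_iterated[of f, OF continuous_on_subset[OF f]] by simp
qed

lemma torus_integral_rotate: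
  assumes f: "continuous_on UNIV f" and per: "\<And>a b. f (a + 1, b) = f (a, b)"
  shows "torus_integral (\<lambda>(a, b). f (- b, a)) = torus_integral f"
proof -
  have c: "continuous_on X (\<lambda>(a, b). f (- b, a))" "continuous_on X (\<lambda>(a, b). f (b, a))" for X
    by (auto simp: case_prod_beta intro!: continuous_intros continuous_on_compose2[OF f])
  have "integral {0..1} (\<lambda>b. f (- b, a)) = integral {0..1} (\<lambda>b. f (b, a))" for a
    using integral_periodic[of "\<lambda>b. f (b, a)" "-1" 0, OF continuous_on_compose2[OF f]] per
    by (simp add: continuous_intros)
  then have "torus_integral (\<lambda>(a, b). f (- b, a)) = torus_integral (\<lambda>(a, b). f (b, a))"
    using torus_integral_iterated[OF c(1)] torus_integral_iterated[OF c(2)] by simp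
  then show ?thesis using torus_integral_swap[OF f] by simp
qed

text \<open>Parseval in \<open>b\<close> for each fixed \<open>a\<close>, followed by unfolding
  \<open>a\<close> over the line. The continuous function \<open>H\<close> stands in for the
  transform because a jump of \<open>f\<close> can make the transform itself discontinuous at
  \<open>a = 1\<close>, which is a null set.\<close>

lemma zak_parseval:
  assumes f [measurable]: "f \<in> borel_measurable borel" and bound: "\<And>x. norm (f x) \<le> K * exp (- \<bar>x\<bar>)"
    and H: "continuous_on (cbox (0, 0) (1, 1)) H"
    and zak: "\<And>a b. \<lbrakk>0 \<le> a; a < 1; 0 \<le> b; b \<le> 1\<rbrakk> \<Longrightarrow> H (a, b) = zak f a b"
  shows "ennreal (torus_integral (\<lambda>x. (norm (H x))\<^sup>2)) = (\<integral>\<^sup>+x. ennreal ((norm (f x))\<^sup>2) \<partial>lborel)"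
proof -
  define G where "G a = integral {0..1} (\<lambda>b. (norm (H (a, b)))\<^sup>2)" for a
  have H2: "continuous_on (cbox (0, 0) (1, 1)) (\<lambda>x. (norm (H x))\<^sup>2)"
    by (intro continuous_intros H)
  have contG: "continuous_on {0..1} G"
    using integral_continuous_on_param[of "{0..1}" 0 1 "\<lambda>a b. (norm (H (a, b)))\<^sup>2"] H2
    by (simp add: G_def case_prod_beta cbox_Pair_eq)
  \<comment> \<open>This is required for every real \<open>a\<close>, also where \<open>H\<close> is
    not controlled; there the integral may be its default value 0.\<close>
  have G0: "0 \<le> G a" for a
    unfolding G_def
    by (cases "(\<lambda>b. (norm (H (a, b)))\<^sup>2) integrable_on {0..1}")
       (auto intro: integral_nonneg simp: not_integrable_integral)
  have "ennreal (torus_integral (\<lambda>x. (norm (H x))\<^sup>2)) = ennreal (integral {0..1} G)"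
    unfolding G_def by (subst torus_integral_iterated[OF H2]) simp
  also have "\<dots> = (\<integral>\<^sup>+a. ennreal (G a) * indicator {0..1} a \<partial>lborel)"
    by (rule nn_integral_has_integral_lebesgue'[symmetric, OF G0])
       (intro integrable_integral integrable_continuous_interval contG)
  also have "\<dots> = (\<integral>\<^sup>+a. (\<Sum>i. ennreal ((norm (f (of_int (int_decode i) - a)))\<^sup>2)) * indicator {0..<1} a \<partial>lborel)"
  proof (rule nn_integral_cong_AE)
    have "AE a in lborel. a \<noteq> (1::real)" by (rule AE_lborel_singleton)
    then show "AE a in lborel. ennreal (G a) * indicator {0..1} a =
       (\<Sum>i. ennreal ((norm (f (of_int (int_decode i) - a)))\<^sup>2)) * indicator {0..<1} a"
    proof eventually_elim
      fix a :: real assume "a \<noteq> 1"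
      show "ennreal (G a) * indicator {0..1} a =
       (\<Sum>i. ennreal ((norm (f (of_int (int_decode i) - a)))\<^sup>2)) * indicator {0..<1} a"
      proof (cases "a \<in> {0..<1}")
        case True
        have "G a = integral {0..1} (\<lambda>b. (norm (zak f a b))\<^sup>2)"
          unfolding G_def by (rule integral_cong) (use True zak in auto)
        then have "((\<lambda>n. (norm (f (of_int n - a)))\<^sup>2) has_sum G a) UNIV"
          using parseval[OF summable_translates[OF bound]] by (simp add: zak_def)
        then have "((\<lambda>i. (norm (f (of_int (int_decode i) - a)))\<^sup>2) has_sum G a) UNIV"
          by (subst has_sum_reindex_bij_betw[OF bij_int_decode, of "\<lambda>n. (norm (f (of_int n - a)))\<^sup>2"])
        then have "(\<lambda>i. (norm (f (of_int (int_decode i) - a)))\<^sup>2) sums G a"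
          by (rule has_sum_imp_sums)
        then have "(\<Sum>i. ennreal ((norm (f (of_int (int_decode i) - a)))\<^sup>2)) = ennreal (G a)"
          by (rule suminf_ennreal_eq[rotated]) simp
        moreover have "indicator {0..1} a = (1::ennreal)" "indicator {0..<1} a = (1::ennreal)"
          using True by (auto simp: indicator_def)
        ultimately show ?thesis by (simp only: mult_1_right)
      next
        case False
        with \<open>a \<noteq> 1\<close> have "indicator {0..1} a = (0::ennreal)" "indicator {0..<1} a = (0::ennreal)"
          by (auto simp: indicator_def)
        then show ?thesis by (simp only: mult_zero_right)
      qed
    qed
  qed
  also have "\<dots> = (\<integral>\<^sup>+x. ennreal ((norm (f x))\<^sup>2) \<partial>lborel)"
    by (rule nn_integral_fold) measurable
  finally show ?thesis .
qed

section \<open>Quasi-periodicity and chirps under the Zak transform\<close>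

lemma zak_add_1_right: "zak f a (b + 1) = zak f a b"
proof -
  have "unit_exp (of_int n * (b + 1)) = unit_exp (of_int n * b)" for n
    by (simp add: ring_distribs unit_exp_add)
  then show ?thesis by (simp add: zak_def)
qed

lemma zak_add_1_left: "zak f (a + 1) b = unit_exp b * zak f a b"
proof -
  have "zak f (a + 1) b = (\<Sum>\<^sub>\<infinity>n. f (of_int (n + 1) - (a + 1)) * unit_exp (of_int (n + 1) * b))"
    unfolding zak_def
    by (rule infsum_reindex_bij_betw[symmetric, of "\<lambda>n. n + 1" UNIV UNIV])
       (auto intro: bij_betw_byWitness[of _ "\<lambda>n. n - 1"])
  also have "\<dots> = (\<Sum>\<^sub>\<infinity>n. unit_exp b * (f (of_int n - a) * unit_exp (of_int n * b)))"
    by (simp add: ring_distribs unit_exp_add mult_ac)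
  finally show ?thesis by (simp add: zak_def infsum_cmult_right')
qed

text \<open>As \<open>n * (n - 1)\<close> is even, \<open>m n^2 / 2\<close> and
  \<open>m n / 2\<close> differ by an integer, so the phase quadratic in \<open>n\<close> becomes a
  linear one, that is, a translation of \<open>b\<close>. The half-integral translation
  \<open>m / 2\<close> is what lets odd \<open>m\<close> act as well.\<close>

lemma zak_chirp:
  "zak (\<lambda>x. unit_exp (of_int m * x\<^sup>2 / 2) * f x) a b =
     unit_exp (of_int m * a\<^sup>2 / 2) * zak f a (b + (of_int m / 2 - of_int m * a))"
proof -
  have "unit_exp (of_int m * (of_int n - a)\<^sup>2 / 2) * unit_exp (of_int n * b) =
     unit_exp (of_int m * a\<^sup>2 / 2) * unit_exp (of_int n * (b + (of_int m / 2 - of_int m * a)))" for n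
  proof -
    have "even (n * (n - 1))" by simp
    then obtain k where k: "n * (n - 1) = 2 * k" by (rule evenE)
    have "real_of_int n * (real_of_int n - 1) = 2 * real_of_int k"
      using arg_cong[OF k, of real_of_int] by simp
    then have k': "real_of_int n * real_of_int n = 2 * real_of_int k + real_of_int n"
      by (simp add: algebra_simps)
    have "of_int m * (of_int n - a)\<^sup>2 / 2 + of_int n * b
        = of_int m * (of_int n * of_int n) / 2 + (of_int m * a\<^sup>2 / 2 + of_int n * (b - of_int m * a))"
      by (simp add: power2_eq_square field_simps)
    also have "\<dots> = of_int (m * k) + (of_int m * a\<^sup>2 / 2 + of_int n * (b + (of_int m / 2 - of_int m * a)))"
      unfolding k' by (simp add: field_simps)
    finally show ?thesis
      by (drule_tac arg_cong[of _ _ unit_exp]) (simp only: unit_exp_add unit_exp_int mult_1)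
  qed
  then have "(unit_exp (of_int m * (of_int n - a)\<^sup>2 / 2) * f (of_int n - a)) * unit_exp (of_int n * b) =
     unit_exp (of_int m * a\<^sup>2 / 2) * (f (of_int n - a) * unit_exp (of_int n * (b + (of_int m / 2 - of_int m * a))))" for n
    by (metis (no_types, lifting) mult.commute mult.left_commute)
  then show ?thesis by (simp only: zak_def infsum_cmult_right')
qed

subsection \<open>Gaussian wave packets\<close>

text \<open>\<^term>\<open>moeb g\<close> is the image of \<open>\<i>\<close> under the Moebius action of \<open>g\<close> and \<^term>\<open>denom g\<close> the factor of automorphy.
  Up to a phase independent of \<open>\<beta>\<close>, \<^term>\<open>packet g \<beta>\<close> is the image of \<open>exp(-\<pi> x\<^sup>2) e(\<beta> x)\<close> under the Weil
  representation of \<open>g\<close>.\<close>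

definition denom :: "real^2^2 \<Rightarrow> complex" where
  "denom g = of_real (g $ 2 $ 1) * \<i> + of_real (g $ 2 $ 2)"

definition moeb :: "real^2^2 \<Rightarrow> complex" where
  "moeb g = (of_real (g $ 1 $ 1) * \<i> + of_real (g $ 1 $ 2)) / denom g"

definition packet :: "real^2^2 \<Rightarrow> real \<Rightarrow> real \<Rightarrow> complex" where
  "packet g \<beta> x = ec (moeb g * of_real x ^ 2 / 2 + of_real \<beta> * of_real x / denom g
      - of_real (g $ 2 $ 1) * of_real \<beta> ^ 2 / (2 * denom g)) / of_real (sqrt (norm (denom g)))"

text \<open>The closed form of the Zak transform of \<open>packet g \<beta>\<close>: the exponent at
  \<open>n - a\<close> splits into a part free of \<open>n\<close> and the exponent of a theta
  series.\<close>

definition theta_packet :: "real^2^2 \<Rightarrow> real \<Rightarrow> real \<times> real \<Rightarrow> complex" where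
  "theta_packet g \<beta> = (\<lambda>(a, b). ec (moeb g * of_real a ^ 2 / 2 - of_real \<beta> * of_real a / denom g
      - of_real (g $ 2 $ 1) * of_real \<beta> ^ 2 / (2 * denom g))
      * theta (moeb g) (of_real \<beta> / denom g - moeb g * of_real a + of_real b) / of_real (sqrt (norm (denom g))))"

text \<open>The list is fixed while \<open>g\<close> varies: it encodes one function at the identity
  together with its images under the whole group.\<close>

definition wave :: "(complex \<times> real) list \<Rightarrow> real^2^2 \<Rightarrow> real \<Rightarrow> complex" where
  "wave cs g x = (\<Sum>(c, \<beta>)\<leftarrow>cs. c * packet g \<beta> x)"

definition theta_wave :: "(complex \<times> real) list \<Rightarrow> real^2^2 \<Rightarrow> real \<times> real \<Rightarrow> complex" where
  "theta_wave cs g p = (\<Sum>(c, \<beta>)\<leftarrow>cs. c * theta_packet g \<beta> p)"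

lemma wave_Nil [simp]: "wave [] g x = 0"
  and wave_Cons [simp]: "wave (z # cs) g x = fst z * packet g (snd z) x + wave cs g x"
  by (simp_all add: wave_def case_prod_beta)

lemma theta_wave_Nil [simp]: "theta_wave [] g p = 0"
  and theta_wave_Cons [simp]: "theta_wave (z # cs) g p = fst z * theta_packet g (snd z) p + theta_wave cs g p"
  by (simp_all add: theta_wave_def case_prod_beta)

lemma denom_nonzero:
  assumes "det g = 1" shows "denom g \<noteq> 0"
proof
  assume "denom g = 0"
  then have "g $ 2 $ 1 = 0 \<and> g $ 2 $ 2 = 0" by (simp add: denom_def complex_eq_iff)
  with assms show False by (simp add: det_2)
qed

lemma Im_moeb:
  assumes "det g = 1" shows "Im (moeb g) = 1 / (norm (denom g))\<^sup>2"
  using assms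
  by (simp add: moeb_def denom_def Im_divide cmod_def det_2 power2_eq_square mult.commute)

lemma Im_moeb_pos: "det g = 1 \<Longrightarrow> 0 < Im (moeb g)"
  using denom_nonzero by (simp add: Im_moeb)

lemma moeb_nonzero: "det g = 1 \<Longrightarrow> moeb g \<noteq> 0"
  using Im_moeb_pos[of g] by auto

lemma packet_has_sum:
  assumes g: "det g = 1"
  shows "((\<lambda>n. packet g \<beta> (of_int n - a) * unit_exp (of_int n * b)) has_sum theta_packet g \<beta> (a, b)) UNIV"
proof -
  define \<tau> j C where "\<tau> = moeb g" and "j = denom g" and "C = complex_of_real (g $ 2 $ 1)"
  have j: "j \<noteq> 0" using denom_nonzero[OF g] by (simp add: j_def)
  define e0 where "e0 = \<tau> * of_real a ^ 2 / 2 - of_real \<beta> * of_real a / j - C * of_real \<beta> ^ 2 / (2 * j)"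
  let ?w = "of_real \<beta> / j - \<tau> * of_real a + of_real b"
  have "packet g \<beta> (of_int n - a) * unit_exp (of_int n * b) =
      ec e0 / of_real (sqrt (norm j)) * ec (\<tau> * of_int n ^ 2 / 2 + ?w * of_int n)" for n
  proof -
    have "(\<tau> * (of_int n - of_real a) ^ 2 / 2 + of_real \<beta> * (of_int n - of_real a) / j - C * of_real \<beta> ^ 2 / (2 * j))
        + of_int n * of_real b = e0 + (\<tau> * of_int n ^ 2 / 2 + ?w * of_int n)"
      using j by (simp add: e0_def power2_eq_square field_simps)
    then have "ec (\<tau> * (of_int n - of_real a) ^ 2 / 2 + of_real \<beta> * (of_int n - of_real a) / j - C * of_real \<beta> ^ 2 / (2 * j))
        * ec (of_int n * of_real b) = ec e0 * ec (\<tau> * of_int n ^ 2 / 2 + ?w * of_int n)"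
      by (simp only: ec_add[symmetric])
    then show ?thesis
      by (simp add: packet_def unit_exp_ec \<tau>_def j_def C_def)
  qed
  moreover have "((\<lambda>n. ec e0 / of_real (sqrt (norm j)) * ec (\<tau> * of_int n ^ 2 / 2 + ?w * of_int n))
      has_sum ec e0 / of_real (sqrt (norm j)) * theta \<tau> ?w) UNIV"
    by (intro has_sum_cmult_right theta_has_sum) (simp add: \<tau>_def Im_moeb_pos g)
  ultimately show ?thesis
    by (simp add: theta_packet_def e0_def \<tau>_def j_def C_def)
qed

lemma zak_wave:
  assumes "det g = 1"
  shows "zak (wave cs g) a b = theta_wave cs g (a, b)"
proof -
  have "((\<lambda>n. wave cs g (of_int n - a) * unit_exp (of_int n * b)) has_sum theta_wave cs g (a, b)) UNIV"
  proof (induction cs)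
    case (Cons z cs)
    have "((\<lambda>n. fst z * (packet g (snd z) (of_int n - a) * unit_exp (of_int n * b))
        + wave cs g (of_int n - a) * unit_exp (of_int n * b)) has_sum theta_wave (z # cs) g (a, b)) UNIV"
      unfolding theta_wave_Cons by (intro has_sum_add has_sum_cmult_right packet_has_sum assms Cons)
    then show ?case by (simp add: algebra_simps)
  qed simp
  then show ?thesis unfolding zak_def by (rule infsumI)
qed

lemma wave_bound:
  assumes g: "det g = 1"
  obtains K where "\<And>x. norm (wave cs g x) \<le> K * exp (- \<bar>x\<bar>)"
proof -
  have packet: "\<exists>K. \<forall>x. norm (packet g \<beta> x) \<le> K * exp (- \<bar>x\<bar>)" for \<beta>
  proof -
    define e0 where "e0 = - of_real (g $ 2 $ 1) * of_real \<beta> ^ 2 / (2 * denom g)"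
    define M where "M = exp ((2 * pi * \<bar>Im (of_real \<beta> / denom g)\<bar> + 1)\<^sup>2 / (4 * pi * Im (moeb g)))"
    have "packet g \<beta> x = ec (moeb g * of_real x ^ 2 / 2 + of_real \<beta> / denom g * of_real x) * ec e0 / of_real (sqrt (norm (denom g)))" for x
      unfolding packet_def e0_def ec_add[symmetric] by simp
    then have "norm (packet g \<beta> x) = norm (ec (moeb g * of_real x ^ 2 / 2 + of_real \<beta> / denom g * of_real x))
        * (norm (ec e0) / sqrt (norm (denom g)))" for x
      by (simp add: norm_mult norm_divide)
    then have "norm (packet g \<beta> x) \<le> M * exp (- \<bar>x\<bar>) * (norm (ec e0) / sqrt (norm (denom g)))" for x
      using norm_gaussian_le[OF Im_moeb_pos[OF g] order_refl order_refl, of x "of_real \<beta> / denom g"]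
      by (simp only: M_def) (rule mult_right_mono, simp_all)
    then show ?thesis
      by (intro exI[of _ "M * (norm (ec e0) / sqrt (norm (denom g)))"]) (simp add: mult_ac)
  qed
  have "\<exists>K. \<forall>x. norm (wave cs g x) \<le> K * exp (- \<bar>x\<bar>)"
  proof (induction cs)
    case Nil
    show ?case by (rule exI[of _ 0]) simp
  next
    case (Cons z cs)
    then obtain K where K: "\<And>x. norm (wave cs g x) \<le> K * exp (- \<bar>x\<bar>)" by blast
    obtain L where L: "\<And>x. norm (packet g (snd z) x) \<le> L * exp (- \<bar>x\<bar>)" using packet by blast
    have "norm (wave (z # cs) g x) \<le> (norm (fst z) * L + K) * exp (- \<bar>x\<bar>)" for x
    proof -
      have "norm (wave (z # cs) g x) \<le> norm (fst z) * norm (packet g (snd z) x) + norm (wave cs g x)"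
        by (metis norm_triangle_ineq norm_mult wave_Cons)
      also have "\<dots> \<le> norm (fst z) * (L * exp (- \<bar>x\<bar>)) + K * exp (- \<bar>x\<bar>)"
        by (intro add_mono mult_left_mono K L) simp
      finally show ?thesis by (simp add: algebra_simps)
    qed
    then show ?case by blast
  qed
  then show thesis using that by blast
qed

lemma continuous_wave [continuous_intros]: "continuous_on S f \<Longrightarrow> continuous_on S (\<lambda>x. wave cs g (f x))"
proof (induction cs)
  case (Cons z cs)
  have "continuous_on S (\<lambda>x. packet g (snd z) (f x))"
    unfolding packet_def divide_inverse by (intro continuous_intros Cons.prems)
  with Cons show ?case by (auto intro!: continuous_intros)
qed simp

lemma borel_measurable_wave [measurable]: "wave cs g \<in> borel_measurable borel"
  by (intro borel_measurable_continuous_onI continuous_intros)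

text \<open>On \<open>det g = 1\<close> the factor \<open>denom g\<close> has no zero and
  \<open>moeb g\<close> stays in the upper half-plane, so continuity of theta suffices. It must be
  joint in \<open>g\<close> and the torus point to pass to the means.\<close>

lemma continuous_theta_wave:
  "continuous_on ({g. det g = 1} \<times> UNIV) (\<lambda>(g, p). theta_wave cs g p)"
proof (induction cs)
  case (Cons z cs)
  have "continuous_on ({g. det g = 1} \<times> UNIV) (\<lambda>(g, p). theta_packet g (snd z) p)"
    unfolding theta_packet_def case_prod_beta moeb_def denom_def
    by (intro continuous_intros)
       (auto simp flip: denom_def moeb_def simp: denom_nonzero Im_moeb_pos)
  with Cons show ?case by (auto simp: case_prod_beta intro!: continuous_intros)
qed (simp add: case_prod_beta)

lemma continuous_theta_wave' [continuous_intros]: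
  assumes "det g = 1" "continuous_on S f"
  shows "continuous_on S (\<lambda>x. theta_wave cs g (f x))"
proof -
  have "continuous_on S (\<lambda>x. (g, f x))" by (intro continuous_intros assms)
  from continuous_on_compose2[OF continuous_theta_wave this, of cs] show ?thesis using assms by auto
qed

subsection \<open>The action of the group\<close>

definition inversion :: "real^2^2" where
  "inversion = vector [vector [0, -1], vector [1, 0]]"

definition dilation :: "real \<Rightarrow> real^2^2" where
  "dilation s = vector [vector [s, 0], vector [0, 1 / s]]"

lemma matrix_mult_2: "(A ** B) $ i $ j = A $ i $ 1 * B $ 1 $ j + A $ i $ 2 * B $ 2 $ j" for A B :: "real^2^2"
  by (simp add: matrix_matrix_mult_def sum_2)

lemma det_upper_unipotent [simp]: "det (upper_unipotent u) = 1"
  and det_inversion [simp]: "det inversion = 1"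
  and det_dilation [simp]: "s \<noteq> 0 \<Longrightarrow> det (dilation s) = 1"
  by (simp_all add: upper_unipotent_def inversion_def dilation_def det_2)

lemma packet_upper_unipotent:
  assumes "det g = 1"
  shows "packet (upper_unipotent u ** g) \<beta> x = unit_exp (u * x\<^sup>2 / 2) * packet g \<beta> x"
proof -
  have d: "denom (upper_unipotent u ** g) = denom g"
    by (simp add: denom_def matrix_mult_2 upper_unipotent_def)
  have m: "moeb (upper_unipotent u ** g) = of_real u + moeb g"
    using denom_nonzero[OF assms]
    by (simp add: moeb_def d field_simps) (simp add: denom_def matrix_mult_2 upper_unipotent_def algebra_simps)
  have c: "(upper_unipotent u ** g) $ 2 $ 1 = g $ 2 $ 1"
    by (simp add: matrix_mult_2 upper_unipotent_def)
  show ?thesis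
    unfolding packet_def m d c unit_exp_ec times_divide_eq_right ec_add[symmetric]
    by (rule arg_cong[of _ _ "\<lambda>z. ec z / _"]) (simp add: field_simps)
qed

text \<open>Both signs of \<open>s\<close> occur in the decomposition of a group element. Since the
  normalization uses only the modulus of \<open>denom g\<close>, the factor is a real square root
  and no branch is chosen.\<close>

lemma packet_dilation:
  assumes "det g = 1" "s \<noteq> 0"
  shows "packet (dilation s ** g) \<beta> x = of_real (sqrt \<bar>s\<bar>) * packet g \<beta> (s * x)"
proof -
  have d: "denom (dilation s ** g) = denom g / of_real s"
    using assms by (simp add: denom_def matrix_mult_2 dilation_def field_simps)
  have m: "moeb (dilation s ** g) = of_real (s\<^sup>2) * moeb g"
    using denom_nonzero[OF assms(1)] assms(2)
    by (simp add: moeb_def d) (simp add: denom_def matrix_mult_2 dilation_def field_simps power2_eq_square)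
  have c: "(dilation s ** g) $ 2 $ 1 = g $ 2 $ 1 / s"
    by (simp add: matrix_mult_2 dilation_def)
  have n: "of_real (sqrt (norm (denom g / of_real s))) = complex_of_real (sqrt (norm (denom g))) / of_real (sqrt \<bar>s\<bar>)"
    by (simp add: norm_divide real_sqrt_divide)
  show ?thesis
    unfolding packet_def m d c n using assms denom_nonzero[OF assms(1)]
    by (simp add: field_simps power2_eq_square)
qed

text \<open>The new factor of automorphy is \<open>\<tau> * j\<close> and, by
  \<open>det g = 1\<close>, the new lower left entry is \<open>C * \<tau> + 1 / j\<close>. With
  \<open>w = \<beta> / j + a + b * \<tau>\<close> the theta argument is \<open>w / \<tau>\<close>,
  and the Gaussian factor of the inversion formula balances the exponents. One \<open>c\<close>
  serves all \<open>\<beta>\<close>, so the law extends to linear combinations.\<close>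

lemma theta_packet_inversion:
  assumes g: "det g = 1"
  obtains c where "\<And>\<beta> a b. theta_packet (inversion ** g) \<beta> (a, b) = c * unit_exp (a * b) * theta_packet g \<beta> (- b, a)"
proof -
  define \<tau> j C where "\<tau> = moeb g" and "j = denom g" and "C = complex_of_real (g $ 2 $ 1)"
  have j: "j \<noteq> 0" using denom_nonzero[OF g] by (simp add: j_def)
  have \<tau>: "\<tau> \<noteq> 0" "0 < Im \<tau>" using moeb_nonzero[OF g] Im_moeb_pos[OF g] by (simp_all add: \<tau>_def)
  obtain c0 where c0: "\<And>w. ec (- w\<^sup>2 / (2 * \<tau>)) * theta (- 1 / \<tau>) (w / \<tau>) = c0 * theta \<tau> w"
    using theta_inversion[OF \<tau>(2)] by blast
  have tj: "\<tau> * j = of_real (g $ 1 $ 1) * \<i> + of_real (g $ 1 $ 2)"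
    using j by (simp add: \<tau>_def j_def moeb_def)
  have d: "denom (inversion ** g) = \<tau> * j"
    unfolding tj by (simp add: denom_def inversion_def matrix_mult_2)
  have m: "moeb (inversion ** g) = - 1 / \<tau>"
    unfolding moeb_def d using \<tau> j
    by (simp add: field_simps) (simp add: inversion_def matrix_mult_2 j_def denom_def algebra_simps)
  have "of_real (g $ 1 $ 1) * j = C * (\<tau> * j) + of_real (det g)"
    unfolding tj det_2 by (simp add: C_def j_def denom_def algebra_simps)
  then have A: "of_real ((inversion ** g) $ 2 $ 1) = C * \<tau> + 1 / j"
    using g j by (simp add: inversion_def matrix_mult_2 field_simps)
  define c where "c = c0 / of_real (sqrt (norm \<tau>))"
  have n: "complex_of_real (sqrt (norm (\<tau> * j))) = of_real (sqrt (norm \<tau>)) * of_real (sqrt (norm j))"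
    by (simp add: norm_mult real_sqrt_mult)
  have "theta_packet (inversion ** g) \<beta> (a, b) = c * unit_exp (a * b) * theta_packet g \<beta> (- b, a)" for \<beta> a b
  proof -
    define w where "w = of_real \<beta> / j + of_real a + of_real b * \<tau>"
    have wt: "w / \<tau> = of_real \<beta> / (\<tau> * j) - - 1 / \<tau> * of_real a + of_real b"
      using \<tau> j by (simp add: w_def field_simps)
    have th: "theta (- 1 / \<tau>) (w / \<tau>) = c0 * ec (w\<^sup>2 / (2 * \<tau>)) * theta \<tau> w"
    proof -
      have "ec (w\<^sup>2 / (2 * \<tau>)) * ec (- w\<^sup>2 / (2 * \<tau>)) = 1" by (simp flip: ec_add)
      then have "theta (- 1 / \<tau>) (w / \<tau>) = ec (w\<^sup>2 / (2 * \<tau>)) * (ec (- w\<^sup>2 / (2 * \<tau>)) * theta (- 1 / \<tau>) (w / \<tau>))"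
        by (simp only: mult.assoc[symmetric] mult_1)
      then show ?thesis unfolding c0 by (simp only: mult_ac)
    qed
    have w: "of_real \<beta> / j - \<tau> * of_real (- b) + of_real a = w"
      by (simp add: w_def)
    have "(- 1 / \<tau> * of_real a ^ 2 / 2 - of_real \<beta> * of_real a / (\<tau> * j) - (C * \<tau> + 1 / j) * of_real \<beta> ^ 2 / (2 * (\<tau> * j)))
      + w\<^sup>2 / (2 * \<tau>) = of_real (a * b) + (\<tau> * of_real (- b) ^ 2 / 2 - of_real \<beta> * of_real (- b) / j - C * of_real \<beta> ^ 2 / (2 * j))"
      using \<tau> j by (simp add: w_def field_simps power2_eq_square)
    then have e: "ec (- 1 / \<tau> * of_real a ^ 2 / 2 - of_real \<beta> * of_real a / (\<tau> * j) - (C * \<tau> + 1 / j) * of_real \<beta> ^ 2 / (2 * (\<tau> * j)))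
      * ec (w\<^sup>2 / (2 * \<tau>)) = unit_exp (a * b) * ec (\<tau> * of_real (- b) ^ 2 / 2 - of_real \<beta> * of_real (- b) / j - C * of_real \<beta> ^ 2 / (2 * j))"
      by (simp only: ec_add[symmetric] unit_exp_ec)
    have "theta_packet (inversion ** g) \<beta> (a, b) =
      ec (- 1 / \<tau> * of_real a ^ 2 / 2 - of_real \<beta> * of_real a / (\<tau> * j) - (C * \<tau> + 1 / j) * of_real \<beta> ^ 2 / (2 * (\<tau> * j)))
      * theta (- 1 / \<tau>) (w / \<tau>) / (of_real (sqrt (norm \<tau>)) * of_real (sqrt (norm j)))"
      unfolding theta_packet_def prod.case m d A wt n ..
    also have "\<dots> = c * (ec (- 1 / \<tau> * of_real a ^ 2 / 2 - of_real \<beta> * of_real a / (\<tau> * j) - (C * \<tau> + 1 / j) * of_real \<beta> ^ 2 / (2 * (\<tau> * j)))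
      * ec (w\<^sup>2 / (2 * \<tau>))) * theta \<tau> w / of_real (sqrt (norm j))"
      unfolding th c_def by simp
    also have "\<dots> = c * unit_exp (a * b) * theta_packet g \<beta> (- b, a)"
      unfolding e theta_packet_def prod.case by (simp only: \<tau>_def[symmetric] j_def[symmetric] C_def[symmetric] w) simp
    finally show ?thesis .
  qed
  with that show thesis by blast
qed

lemma wave_upper_unipotent:
  assumes "det g = 1"
  shows "wave cs (upper_unipotent u ** g) x = unit_exp (u * x\<^sup>2 / 2) * wave cs g x"
  by (induction cs) (simp_all add: packet_upper_unipotent[OF assms] ring_distribs)

lemma wave_dilation:
  assumes "det g = 1" "s \<noteq> 0"
  shows "wave cs (dilation s ** g) x = of_real (sqrt \<bar>s\<bar>) * wave cs g (s * x)"
  by (induction cs) (simp_all add: packet_dilation[OF assms] ring_distribs)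

lemma theta_wave_upper_unipotent:
  assumes "det g = 1"
  shows "theta_wave cs (upper_unipotent (of_int m) ** g) (a, b) =
    unit_exp (of_int m * a\<^sup>2 / 2) * theta_wave cs g (a, b + (of_int m / 2 - of_int m * a))"
proof -
  have "det (upper_unipotent (of_int m) ** g) = 1" using assms by (simp add: det_mul)
  moreover have "wave cs (upper_unipotent (of_int m) ** g) = (\<lambda>x. unit_exp (of_int m * x\<^sup>2 / 2) * wave cs g x)"
    by (rule ext) (rule wave_upper_unipotent[OF assms])
  ultimately show ?thesis
    by (simp only: zak_wave[symmetric] zak_wave[OF assms, symmetric] zak_chirp)
qed

lemma theta_wave_add_1:
  assumes "det g = 1"
  shows "theta_wave cs g (a + 1, b) = unit_exp b * theta_wave cs g (a, b)"
    and "theta_wave cs g (a, b + 1) = theta_wave cs g (a, b)"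
  by (simp_all add: zak_wave[OF assms, symmetric] zak_add_1_left zak_add_1_right)

section \<open>\<open>L^2\<close> norms on the torus and on the line\<close>

lemma energy_eq:
  assumes "det g = 1"
  shows "ennreal (torus_integral (\<lambda>p. (norm (theta_wave cs g p))\<^sup>2)) = (\<integral>\<^sup>+x. ennreal ((norm (wave cs g x))\<^sup>2) \<partial>lborel)"
proof -
  obtain K where K: "\<And>x. norm (wave cs g x) \<le> K * exp (- \<bar>x\<bar>)" using wave_bound[OF assms] by blast
  show ?thesis
    by (rule zak_parseval[OF _ K]) (auto simp: zak_wave[OF assms] intro!: continuous_intros assms)
qed

lemma torus_integral_nonneg: "(\<And>p. 0 \<le> f p) \<Longrightarrow> 0 \<le> torus_integral f"
  unfolding torus_integral_def
  by (cases "f integrable_on cbox (0, 0) (1, 1)") (auto intro: integral_nonneg simp: not_integrable_integral)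

lemma torus_integral_cmult: "torus_integral (\<lambda>p. c * f p) = c * torus_integral f"
  by (simp add: torus_integral_def)

text \<open>The factor \<open>c\<close> is kept inside \<open>F\<close> because this is used twice:
  with the squared norm, to show that \<open>c\<close> has modulus 1, and afterwards to remove
  \<open>c\<close>. Invariance of \<open>F\<close> under rotations disposes of the phase
  \<open>unit_exp (a * b)\<close> and of the factor by which \<open>theta_wave\<close> fails to be
  periodic in \<open>a\<close>.\<close>

lemma torus_integral_theta_wave_inversion:
  assumes g: "det g = 1" and F: "continuous_on UNIV F" and rot: "\<And>u z. norm u = 1 \<Longrightarrow> F (u * z) = F z"
    and law: "\<And>a b. theta_wave cs (inversion ** g) (a, b) = c * unit_exp (a * b) * theta_wave cs g (- b, a)"
  shows "torus_integral (\<lambda>p. F (theta_wave cs (inversion ** g) p)) = torus_integral (\<lambda>p. F (c * theta_wave cs g p))"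
proof -
  have "F (theta_wave cs (inversion ** g) (a, b)) = F (c * theta_wave cs g (- b, a))" for a b
    using rot[of "unit_exp (a * b)" "c * theta_wave cs g (- b, a)"] by (simp add: law mult_ac)
  then have "torus_integral (\<lambda>p. F (theta_wave cs (inversion ** g) p))
     = torus_integral (\<lambda>(a, b). F (c * theta_wave cs g (- b, a)))"
    by (intro arg_cong[of _ _ torus_integral]) auto
  also have "\<dots> = torus_integral (\<lambda>p. F (c * theta_wave cs g p))"
  proof (rule torus_integral_rotate)
    show "continuous_on UNIV (\<lambda>p. F (c * theta_wave cs g p))"
      by (intro continuous_on_compose2[OF F] continuous_intros g) auto
    show "F (c * theta_wave cs g (a + 1, b)) = F (c * theta_wave cs g (a, b))" for a b
      using rot[of "unit_exp b" "c * theta_wave cs g (a, b)"] by (simp add: theta_wave_add_1[OF g] mult_ac)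
  qed
  finally show ?thesis .
qed

text \<open>For \<open>\<beta> = 0\<close> the squared modulus is a Gaussian of width proportional
  to \<open>norm (denom g)\<close>; rescaling by that width removes \<open>g\<close>.\<close>

lemma energy_single:
  assumes g: "det g = 1"
  shows "(\<integral>\<^sup>+x. ennreal ((norm (wave [(1, 0)] g x))\<^sup>2) \<partial>lborel) = (\<integral>\<^sup>+x. ennreal (exp (- 2 * pi * x\<^sup>2)) \<partial>lborel)"
proof -
  let ?r = "norm (denom g)"
  have r: "0 < ?r" using denom_nonzero[OF g] by simp
  have "(norm (wave [(1, 0)] g x))\<^sup>2 = exp (- 2 * pi * x\<^sup>2 / ?r\<^sup>2) / ?r" for x
  proof -
    have "norm (packet g 0 x) = exp (- pi * x\<^sup>2 / ?r\<^sup>2) / sqrt ?r"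
      by (simp add: packet_def norm_divide norm_ec Im_moeb[OF g] Im_divide_of_real power2_eq_square)
    then have "(norm (packet g 0 x))\<^sup>2 = (exp (- pi * x\<^sup>2 / ?r\<^sup>2))\<^sup>2 / ?r"
      by (simp add: power_divide)
    also have "(exp (- pi * x\<^sup>2 / ?r\<^sup>2))\<^sup>2 = exp (- 2 * pi * x\<^sup>2 / ?r\<^sup>2)"
      by (simp flip: exp_double)
    finally show ?thesis by simp
  qed
  then have "(\<integral>\<^sup>+x. ennreal ((norm (wave [(1, 0)] g x))\<^sup>2) \<partial>lborel) = (\<integral>\<^sup>+x. ennreal (exp (- 2 * pi * x\<^sup>2 / ?r\<^sup>2) / ?r) \<partial>lborel)"
    by simp
  also have "\<dots> = ennreal \<bar>?r\<bar> * (\<integral>\<^sup>+x. ennreal (exp (- 2 * pi * (0 + ?r * x)\<^sup>2 / ?r\<^sup>2) / ?r) \<partial>lborel)"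
    using r by (intro nn_integral_real_affine) (auto intro!: borel_measurable_continuous_onI continuous_intros)
  also have "\<dots> = (\<integral>\<^sup>+x. ennreal ?r * ennreal (exp (- 2 * pi * (0 + ?r * x)\<^sup>2 / ?r\<^sup>2) / ?r) \<partial>lborel)"
    using r by (subst nn_integral_cmult) (auto intro!: borel_measurable_continuous_onI continuous_intros)
  also have "\<dots> = (\<integral>\<^sup>+x. ennreal (exp (- 2 * pi * x\<^sup>2)) \<partial>lborel)"
    using r by (intro nn_integral_cong) (simp flip: ennreal_mult add: power_mult_distrib)
  finally show ?thesis .
qed

text \<open>The modulus of the constant in the inversion formula is found by comparing the \<open>L\<^sup>2\<close> norms of a single
  Gaussian before and after inversion.\<close>

lemma theta_wave_inversion:
  assumes g: "det g = 1"
  obtains c where "norm c = 1"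
    "\<And>cs a b. theta_wave cs (inversion ** g) (a, b) = c * unit_exp (a * b) * theta_wave cs g (- b, a)"
proof -
  obtain c where c: "\<And>\<beta> a b. theta_packet (inversion ** g) \<beta> (a, b) = c * unit_exp (a * b) * theta_packet g \<beta> (- b, a)"
    using theta_packet_inversion[OF g] by blast
  have law: "theta_wave cs (inversion ** g) (a, b) = c * unit_exp (a * b) * theta_wave cs g (- b, a)" for cs a b
    by (induction cs) (simp_all add: c ring_distribs mult_ac)
  let ?E = "\<lambda>g. torus_integral (\<lambda>p. (norm (theta_wave [(1, 0)] g p))\<^sup>2)"
  have g': "det (inversion ** g) = 1" using g by (simp add: det_mul)
  have "ennreal (?E (inversion ** g)) = ennreal (?E g)"
    unfolding energy_eq[OF g] energy_eq[OF g'] energy_single[OF g] energy_single[OF g'] ..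
  then have same: "?E (inversion ** g) = ?E g"
    by (simp add: torus_integral_nonneg)
  have "?E (inversion ** g) = torus_integral (\<lambda>p. (norm (c * theta_wave [(1, 0)] g p))\<^sup>2)"
    by (rule torus_integral_theta_wave_inversion[OF g _ _ law]) (auto simp: norm_mult intro!: continuous_intros)
  also have "\<dots> = (norm c)\<^sup>2 * ?E g"
    by (simp add: norm_mult power_mult_distrib torus_integral_cmult)
  finally have E: "?E g = (norm c)\<^sup>2 * ?E g" using same by simp
  have "?E g \<noteq> 0"
  proof
    assume "?E g = 0"
    then have "(\<integral>\<^sup>+x. ennreal (exp (- 2 * pi * x\<^sup>2)) \<partial>lborel) = 0"
      using energy_eq[OF g, of "[(1, 0)]"] energy_single[OF g] by simp
    then have "AE x in lborel. ennreal (exp (- 2 * pi * (x::real)\<^sup>2)) = 0"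
      by (subst (asm) nn_integral_0_iff_AE) (auto intro!: borel_measurable_continuous_onI continuous_intros)
    then have "AE x in (lborel :: real measure). False" by simp
    then show False by (simp add: eventually_False ae_filter_eq_bot_iff)
  qed
  with E have "norm c = 1" using norm_ge_zero[of c] by (auto simp: power2_eq_1_iff simp del: norm_ge_zero)
  with law that show thesis by blast
qed

text \<open>The Bruhat decomposition, phrased as an induction over left multiplication by
  generators: upper triangular matrices if the lower left entry vanishes, otherwise a unipotent
  times the inversion times a diagonal matrix times a unipotent.\<close>

lemma SL2R_generated:
  assumes g: "det g = 1"
    and unipotent: "\<And>u g. det g = 1 \<Longrightarrow> P g \<Longrightarrow> P (upper_unipotent u ** g)"
    and dilation: "\<And>s g. s \<noteq> 0 \<Longrightarrow> det g = 1 \<Longrightarrow> P g \<Longrightarrow> P (dilation s ** g)"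
    and inversion: "\<And>g. det g = 1 \<Longrightarrow> P g \<Longrightarrow> P (inversion ** g)"
    and one: "P (mat 1)"
  shows "P g"
proof (cases "g $ 2 $ 1 = 0")
  case True
  let ?s = "g $ 1 $ 1"
  have s: "?s * g $ 2 $ 2 = 1" using g True by (simp add: det_2)
  then have "?s \<noteq> 0" by auto
  have "g = upper_unipotent (?s * g $ 1 $ 2) ** (dilation ?s ** mat 1)"
    using s True \<open>?s \<noteq> 0\<close>
    by (simp add: vec_eq_iff forall_2 matrix_mult_2 upper_unipotent_def dilation_def field_simps)
  moreover have "P \<dots>"
    using \<open>?s \<noteq> 0\<close> by (intro unipotent dilation one) (auto simp: det_mul)
  ultimately show ?thesis by simp
next
  case False
  let ?c = "g $ 2 $ 1"
  have "g = upper_unipotent (g $ 1 $ 1 / ?c) ** (inversion ** (dilation ?c ** (upper_unipotent (g $ 2 $ 2 / ?c) ** mat 1)))"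
    using g False
    by (simp add: vec_eq_iff forall_2 matrix_mult_2 upper_unipotent_def dilation_def inversion_def field_simps det_2)
  moreover have "P \<dots>"
    using False by (intro unipotent dilation inversion one) (auto simp: det_mul)
  ultimately show ?thesis by simp
qed

text \<open>Unitarity on generators. Real unipotents multiply by a unimodular chirp and dilations
  are a change of variables on the line; the inversion is treated on the torus, where it is a
  rotation up to phase, and carried back by \<open>energy_eq\<close>.\<close>

lemma energy_invariant:
  assumes "det g = 1"
  shows "(\<integral>\<^sup>+x. ennreal ((norm (wave cs g x))\<^sup>2) \<partial>lborel) = (\<integral>\<^sup>+x. ennreal ((norm (wave cs (mat 1) x))\<^sup>2) \<partial>lborel)"
proof (rule SL2R_generated[OF assms])
  fix u :: real and g :: "real^2^2"
  assume g: "det g = 1" and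
    IH: "(\<integral>\<^sup>+x. ennreal ((norm (wave cs g x))\<^sup>2) \<partial>lborel) = (\<integral>\<^sup>+x. ennreal ((norm (wave cs (mat 1) x))\<^sup>2) \<partial>lborel)"
  show "(\<integral>\<^sup>+x. ennreal ((norm (wave cs (upper_unipotent u ** g) x))\<^sup>2) \<partial>lborel) = (\<integral>\<^sup>+x. ennreal ((norm (wave cs (mat 1) x))\<^sup>2) \<partial>lborel)"
    by (simp add: wave_upper_unipotent[OF g] norm_mult IH)
next
  fix s :: real and g :: "real^2^2"
  assume s: "s \<noteq> 0" and g: "det g = 1" and
    IH: "(\<integral>\<^sup>+x. ennreal ((norm (wave cs g x))\<^sup>2) \<partial>lborel) = (\<integral>\<^sup>+x. ennreal ((norm (wave cs (mat 1) x))\<^sup>2) \<partial>lborel)"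
  have "(\<integral>\<^sup>+x. ennreal ((norm (wave cs (dilation s ** g) x))\<^sup>2) \<partial>lborel) =
      (\<integral>\<^sup>+x. ennreal \<bar>s\<bar> * ennreal ((norm (wave cs g (0 + s * x)))\<^sup>2) \<partial>lborel)"
    by (simp add: wave_dilation[OF g s] norm_mult power_mult_distrib ennreal_mult)
  also have "\<dots> = ennreal \<bar>s\<bar> * (\<integral>\<^sup>+x. ennreal ((norm (wave cs g (0 + s * x)))\<^sup>2) \<partial>lborel)"
    by (rule nn_integral_cmult) measurable
  also have "\<dots> = (\<integral>\<^sup>+x. ennreal ((norm (wave cs g x))\<^sup>2) \<partial>lborel)"
    by (rule nn_integral_real_affine[OF _ s, symmetric]) measurable
  finally show "(\<integral>\<^sup>+x. ennreal ((norm (wave cs (dilation s ** g) x))\<^sup>2) \<partial>lborel) = (\<integral>\<^sup>+x. ennreal ((norm (wave cs (mat 1) x))\<^sup>2) \<partial>lborel)"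
    by (simp add: IH)
next
  fix g :: "real^2^2"
  assume g: "det g = 1" and
    IH: "(\<integral>\<^sup>+x. ennreal ((norm (wave cs g x))\<^sup>2) \<partial>lborel) = (\<integral>\<^sup>+x. ennreal ((norm (wave cs (mat 1) x))\<^sup>2) \<partial>lborel)"
  obtain c where c: "norm c = 1"
    and law: "\<And>cs a b. theta_wave cs (inversion ** g) (a, b) = c * unit_exp (a * b) * theta_wave cs g (- b, a)"
    using theta_wave_inversion[OF g] by blast
  have "torus_integral (\<lambda>p. (norm (theta_wave cs (inversion ** g) p))\<^sup>2) = torus_integral (\<lambda>p. (norm (c * theta_wave cs g p))\<^sup>2)"
    by (rule torus_integral_theta_wave_inversion[OF g _ _ law]) (auto simp: norm_mult intro!: continuous_intros)
  also have "\<dots> = torus_integral (\<lambda>p. (norm (theta_wave cs g p))\<^sup>2)"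
    by (simp add: norm_mult c)
  finally have "ennreal (torus_integral (\<lambda>p. (norm (theta_wave cs (inversion ** g) p))\<^sup>2))
      = ennreal (torus_integral (\<lambda>p. (norm (theta_wave cs g p))\<^sup>2))" by simp
  moreover have "det (inversion ** g) = 1" using g by (simp add: det_mul)
  ultimately show "(\<integral>\<^sup>+x. ennreal ((norm (wave cs (inversion ** g) x))\<^sup>2) \<partial>lborel) = (\<integral>\<^sup>+x. ennreal ((norm (wave cs (mat 1) x))\<^sup>2) \<partial>lborel)"
    by (simp only: energy_eq energy_eq[OF g] IH)
qed simp

text \<open>The Euclidean algorithm on the lower left entry \<open>c\<close>. When
  \<open>c = 0\<close> the diagonal is 1 or -1, and minus the identity is the square of the
  inversion.\<close>

lemma SL2Z_invariant:
  fixes f :: "real^2^2 \<Rightarrow> 'a"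
  assumes unipotent: "\<And>m g. det g = 1 \<Longrightarrow> f (upper_unipotent (of_int m) ** g) = f g"
    and inv: "\<And>g. det g = 1 \<Longrightarrow> f (inversion ** g) = f g"
    and \<gamma>: "\<gamma> \<in> SL2Z" and g: "det g = 1"
  shows "f (\<gamma> ** g) = f g"
proof -
  define M :: "int \<Rightarrow> int \<Rightarrow> int \<Rightarrow> int \<Rightarrow> real^2^2"
    where "M a b c d = vector [vector [of_int a, of_int b], vector [of_int c, of_int d]]" for a b c d
  have detM: "det (M a b c d ** g) = of_int (a * d - b * c)" for a b c d
    unfolding det_mul g by (simp add: M_def det_2)
  have M: "f (M a b c d ** g) = f g" if "a * d - b * c = 1" for a b c d
    using that
  proof (induction "nat \<bar>c\<bar>" arbitrary: a b c d rule: less_induct)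
    case less
    show ?case
    proof (cases "c = 0")
      case True
      with less.prems have "a = 1 \<and> d = 1 \<or> a = - 1 \<and> d = - 1"
        by (simp add: zmult_eq_1_iff)
      then show ?thesis
      proof
        assume "a = 1 \<and> d = 1"
        then have "M a b c d ** g = upper_unipotent (of_int b) ** g"
          using True by (simp add: M_def upper_unipotent_def)
        then show ?thesis using unipotent[OF g] by simp
      next
        assume "a = - 1 \<and> d = - 1"
        then have "M a b c d ** g = inversion ** (inversion ** (upper_unipotent (of_int (- b)) ** g))"
          using True by (simp add: M_def upper_unipotent_def inversion_def vec_eq_iff forall_2 matrix_mult_2)
        then show ?thesis using g unipotent[OF g, of "- b"] by (simp add: inv det_mul)
      qed
    next
      case False
      \<comment> \<open>Subtracting \<open>q\<close> times the lower row leaves \<open>r\<close> in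
        the upper row; the inversion then moves \<open>r\<close> to the lower left corner, where its
        modulus is below that of \<open>c\<close>.\<close>
      define q r b' where "q = a div c" and "r = a mod c" and "b' = b - q * d"
      have a: "a = q * c + r" by (simp add: q_def r_def)
      have det: "r * d - b' * c = 1"
        using less.prems by (simp add: b'_def a algebra_simps)
      have "\<bar>r\<bar> < \<bar>c\<bar>" unfolding r_def using False by (rule abs_mod_less)
      then have IH: "f (M (- c) (- d) r b' ** g) = f g"
        using det by (intro less.hyps) (auto simp: algebra_simps)
      have "M a b c d ** g = upper_unipotent (of_int q) ** (M r b' c d ** g)"
        by (simp add: M_def upper_unipotent_def vec_eq_iff forall_2 matrix_mult_2 a b'_def algebra_simps)
      moreover have "M (- c) (- d) r b' ** g = inversion ** (M r b' c d ** g)"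
        by (simp add: M_def inversion_def vec_eq_iff forall_2 matrix_mult_2)
      ultimately show ?thesis
        using IH det detM[of r b' c d] by (simp add: unipotent inv)
    qed
  qed
  obtain a b c d where abcd: "\<gamma> $ 1 $ 1 = of_int a" "\<gamma> $ 1 $ 2 = of_int b" "\<gamma> $ 2 $ 1 = of_int c" "\<gamma> $ 2 $ 2 = of_int d"
    using \<gamma> unfolding SL2Z_def Ints_def by (simp add: image_iff) metis
  have "det \<gamma> = 1" using \<gamma> by (simp add: SL2Z_def)
  then have "real_of_int (a * d - b * c) = of_int 1" by (simp add: det_2 abcd)
  then have "a * d - b * c = 1" by (simp only: of_int_eq_iff)
  moreover have "\<gamma> = M a b c d" by (simp add: M_def vec_eq_iff forall_2 abcd)
  ultimately show ?thesis using M by simp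
qed

section \<open>Means over the torus as invariant functions on the group\<close>

definition theta_mean :: "(complex \<Rightarrow> real) \<Rightarrow> (complex \<times> real) list \<Rightarrow> real^2^2 \<Rightarrow> real" where
  "theta_mean F cs g = torus_integral (\<lambda>p. F (theta_wave cs g p))"

lemma continuous_theta_mean:
  assumes "continuous_on UNIV F"
  shows "continuous_on {g. det g = 1} (theta_mean F cs)"
  unfolding theta_mean_def torus_integral_def
proof (rule integral_continuous_on_param)
  have "continuous_on ({g. det g = 1} \<times> cbox (0, 0) (1, 1)) (\<lambda>(g, p). theta_wave cs g p)"
    by (rule continuous_on_subset[OF continuous_theta_wave]) auto
  from continuous_on_compose2[OF assms this]
  show "continuous_on ({g. det g = 1} \<times> cbox (0, 0) (1, 1)) (\<lambda>(g, p). F (theta_wave cs g p))"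
    by (simp add: case_prod_beta)
qed

lemma theta_mean_SL2Z:
  assumes F: "continuous_on UNIV F" and rot: "\<And>u z. norm u = 1 \<Longrightarrow> F (u * z) = F z"
    and "\<gamma> \<in> SL2Z" "det g = 1"
  shows "theta_mean F cs (\<gamma> ** g) = theta_mean F cs g"
proof (rule SL2Z_invariant[OF _ _ assms(3,4)])
  fix m and g :: "real^2^2" assume g: "det g = 1"
  have "theta_mean F cs (upper_unipotent (of_int m) ** g)
     = torus_integral (\<lambda>(a, b). F (theta_wave cs g (a, b + (of_int m / 2 - of_int m * a))))"
    unfolding theta_mean_def
    by (intro arg_cong[of _ _ torus_integral]) (auto simp: theta_wave_upper_unipotent[OF g] rot)
  also have "\<dots> = theta_mean F cs g"
    unfolding theta_mean_def
    by (rule torus_integral_shear)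
       (auto simp: theta_wave_add_1[OF g] intro!: continuous_intros continuous_on_compose2[OF F] g)
  finally show "theta_mean F cs (upper_unipotent (of_int m) ** g) = theta_mean F cs g" .
next
  fix g :: "real^2^2" assume g: "det g = 1"
  obtain c where c: "norm c = 1"
    and law: "\<And>cs a b. theta_wave cs (inversion ** g) (a, b) = c * unit_exp (a * b) * theta_wave cs g (- b, a)"
    using theta_wave_inversion[OF g] by blast
  show "theta_mean F cs (inversion ** g) = theta_mean F cs g"
    using torus_integral_theta_wave_inversion[OF g F rot law] by (simp add: theta_mean_def rot[OF c])
qed

subsection \<open>Comparison of means\<close>

text \<open>\<open>F\<close> need not be uniformly continuous on the plane. For
  \<open>norm z \<ge> R\<close>, with \<open>e * R\<^sup>2 = 2 * B\<close>, the trivial bound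
  \<open>2 * B\<close> is absorbed by \<open>e * (norm z)\<^sup>2\<close>; for distant
  \<open>z\<close> and \<open>w\<close> it is absorbed by the last term. The remaining pairs lie in
  the ball of radius \<open>R + 1\<close>, as \<open>d \<le> 1\<close>. All error terms are
  quadratic, so second moments control their integrals.\<close>

lemma bounded_continuous_modulus:
  fixes F :: "complex \<Rightarrow> real"
  assumes F: "continuous_on UNIV F" and bdd: "bounded (range F)" and e: "e > 0"
  obtains D where "D \<ge> 0" "\<And>z w. \<bar>F z - F w\<bar> \<le> e * (1 + (norm z)\<^sup>2) + D * (norm (z - w))\<^sup>2"
proof -
  obtain B where B: "B > 0" "\<And>z. \<bar>F z\<bar> \<le> B"
    using bdd unfolding bounded_pos by auto
  define R where "R = sqrt (2 * B / e)"
  have R: "R \<ge> 0" "R\<^sup>2 = 2 * B / e" using B e by (simp_all add: R_def)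
  have "uniformly_continuous_on (cball 0 (R + 1)) F"
    by (intro compact_uniformly_continuous continuous_on_subset[OF F]) auto
  then obtain d0 where d0: "d0 > 0"
    "\<And>z w. \<lbrakk>z \<in> cball 0 (R + 1); w \<in> cball 0 (R + 1); dist w z < d0\<rbrakk> \<Longrightarrow> dist (F w) (F z) < e"
    unfolding uniformly_continuous_on_def using e by metis
  define d where "d = min d0 1"
  have d: "d > 0" "d \<le> 1" "d \<le> d0" using d0 by (auto simp: d_def)
  have "\<bar>F z - F w\<bar> \<le> e * (1 + (norm z)\<^sup>2) + 2 * B / d\<^sup>2 * (norm (z - w))\<^sup>2" for z w
  proof -
    have 2: "\<bar>F z - F w\<bar> \<le> 2 * B" using B(2)[of z] B(2)[of w] by linarith
    have pos: "0 \<le> e * (norm z)\<^sup>2" "0 \<le> 2 * B / d\<^sup>2 * (norm (z - w))\<^sup>2" using B e by simp_all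
    consider "R \<le> norm z" | "d \<le> norm (z - w)" | "norm z < R" "norm (z - w) < d" by linarith
    then show ?thesis
    proof cases
      case 1
      then have "R\<^sup>2 \<le> (norm z)\<^sup>2" using R by (intro power_mono)
      then have "2 * B \<le> e * (norm z)\<^sup>2" unfolding R(2) using e by (simp add: field_simps)
      with 2 pos e show ?thesis unfolding ring_distribs by linarith
    next
      case 2
      then have "d\<^sup>2 \<le> (norm (z - w))\<^sup>2" using d by (intro power_mono) auto
      then have "2 * B / d\<^sup>2 * d\<^sup>2 \<le> 2 * B / d\<^sup>2 * (norm (z - w))\<^sup>2"
        using B by (intro mult_left_mono) auto
      then have "2 * B \<le> 2 * B / d\<^sup>2 * (norm (z - w))\<^sup>2" using d by simp
      with \<open>\<bar>F z - F w\<bar> \<le> 2 * B\<close> pos e show ?thesis unfolding ring_distribs by linarith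
    next
      case 3
      have "norm w \<le> norm z + norm (z - w)" by (metis norm_minus_commute norm_triangle_sub add.commute)
      with 3 d have "z \<in> cball 0 (R + 1)" "w \<in> cball 0 (R + 1)" "dist w z < d0"
        by (auto simp: dist_norm norm_minus_commute)
      from d0(2)[OF this] have "\<bar>F z - F w\<bar> < e" by (simp add: dist_real_def abs_minus_commute)
      with pos show ?thesis unfolding ring_distribs by linarith
    qed
  qed
  then show thesis using B by (intro that[of "2 * B / d\<^sup>2"]) auto
qed

lemma torus_integral_close:
  fixes F :: "complex \<Rightarrow> real"
  assumes F: "continuous_on UNIV F"
    and mod: "\<And>z w. \<bar>F z - F w\<bar> \<le> e * (1 + (norm z)\<^sup>2) + D * (norm (z - w))\<^sup>2"
    and H: "continuous_on UNIV H1" "continuous_on UNIV H2"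
  shows "\<bar>torus_integral (\<lambda>p. F (H1 p)) - torus_integral (\<lambda>p. F (H2 p))\<bar>
    \<le> e * (1 + torus_integral (\<lambda>p. (norm (H1 p))\<^sup>2)) + D * torus_integral (\<lambda>p. (norm (H1 p - H2 p))\<^sup>2)"
proof -
  let ?Q = "cbox (0::real, 0::real) (1, 1)"
  have Hc: "continuous_on ?Q H1" "continuous_on ?Q H2" using H by (auto intro: continuous_on_subset)
  have FH: "continuous_on ?Q (\<lambda>p. F (H1 p))" "continuous_on ?Q (\<lambda>p. F (H2 p))"
    by (auto intro!: continuous_on_compose2[OF F] Hc)
  have s: "continuous_on ?Q (\<lambda>p. (norm (H1 p))\<^sup>2)" "continuous_on ?Q (\<lambda>p. (norm (H1 p - H2 p))\<^sup>2)"
    by (intro continuous_intros Hc)+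
  have "torus_integral (\<lambda>p. F (H1 p)) - torus_integral (\<lambda>p. F (H2 p)) = torus_integral (\<lambda>p. F (H1 p) - F (H2 p))"
    unfolding torus_integral_def by (intro integral_diff[symmetric] integrable_continuous FH)
  also have "\<bar>\<dots>\<bar> \<le> torus_integral (\<lambda>p. e * (1 + (norm (H1 p))\<^sup>2) + D * (norm (H1 p - H2 p))\<^sup>2)"
    unfolding torus_integral_def real_norm_def[symmetric]
    by (rule integral_norm_bound_integral)
       (auto intro!: integrable_continuous continuous_intros FH Hc mod)
  also have "\<dots> = e * (1 + torus_integral (\<lambda>p. (norm (H1 p))\<^sup>2)) + D * torus_integral (\<lambda>p. (norm (H1 p - H2 p))\<^sup>2)"
  proof -
    have "torus_integral (\<lambda>p. e * (1 + (norm (H1 p))\<^sup>2) + D * (norm (H1 p - H2 p))\<^sup>2) =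
        torus_integral (\<lambda>p. e * (1 + (norm (H1 p))\<^sup>2)) + torus_integral (\<lambda>p. D * (norm (H1 p - H2 p))\<^sup>2)"
      unfolding torus_integral_def by (intro integral_add integrable_continuous continuous_intros Hc)
    moreover have "torus_integral (\<lambda>p. 1 + (norm (H1 p))\<^sup>2) = torus_integral (\<lambda>p. 1) + torus_integral (\<lambda>p. (norm (H1 p))\<^sup>2)"
      unfolding torus_integral_def by (intro integral_add integrable_continuous continuous_intros Hc)
    moreover have "torus_integral (\<lambda>p. 1) = 1"
      by (simp add: torus_integral_def content_Pair)
    ultimately show ?thesis by (simp add: torus_integral_cmult)
  qed
  finally show ?thesis .
qed

subsection \<open>Approximation of the indicator function\<close>

lemma nn_integral_gaussian: "(\<integral>\<^sup>+x. ennreal (exp (- pi * x\<^sup>2)) \<partial>lborel) = 1"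
proof -
  let ?s = "1 / sqrt (2 * pi)"
  have eq: "normal_density 0 ?s x = exp (- pi * x\<^sup>2)" for x
    by (simp add: normal_density_def power_divide field_simps)
  have "(\<integral>\<^sup>+x. ennreal (normal_density 0 ?s x) \<partial>lborel) = ennreal (\<integral>x. normal_density 0 ?s x \<partial>lborel)"
    by (intro nn_integral_eq_integral integrable_normal_density) auto
  also have "\<dots> = 1" by (subst integral_normal_density) auto
  finally show ?thesis by (simp only: eq)
qed

text \<open>At the identity, packets with frequencies in \<open>(1/L) Z\<close> span the Gaussian
  times \<open>L\<close>-periodic trigonometric polynomials, which gives access to
  \<open>trig_dense\<close>.\<close>

lemma wave_one: "wave (map (\<lambda>(c, n). (c, of_int n / L)) cs) (mat 1) x = of_real (exp (- pi * x\<^sup>2)) * trig cs (x / L)"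
proof -
  have d: "denom (mat 1) = 1" "moeb (mat 1) = \<i>"
    by (simp_all add: denom_def moeb_def mat_def)
  have p: "packet (mat 1) \<beta> x = of_real (exp (- pi * x\<^sup>2)) * unit_exp (\<beta> * x)" for \<beta>
  proof -
    have "ec (\<i> * of_real x ^ 2 / 2) = of_real (exp (- pi * x\<^sup>2))"
    proof -
      have "2 * of_real pi * \<i> * (\<i> * of_real x ^ 2 / 2) = complex_of_real (- pi * x\<^sup>2)"
        by (simp add: complex_eq_iff power2_eq_square)
      then show ?thesis unfolding ec_def exp_of_real[symmetric] by (rule arg_cong)
    qed
    then show ?thesis
      by (simp add: packet_def d) (simp add: mat_def ec_add unit_exp_ec)
  qed
  show ?thesis
    by (induction cs) (auto simp: p algebra_simps case_prod_beta)
qed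

text \<open>A trapezoid with slopes \<open>1 / h\<close> at both ends of the unit interval. For
  \<open>h \<ge> 1/2\<close> it degenerates, but then the two error intervals cover the unit
  interval.\<close>

lemma tent_approximation:
  fixes h :: real
  assumes h: "0 < h"
  obtains t :: "real \<Rightarrow> real" where "continuous_on UNIV t" "\<And>x. \<bar>t x\<bar> \<le> 1" "\<And>x. x \<notin> {0<..<1} \<Longrightarrow> t x = 0"
    and "\<And>x. (t x - indicator {0<..1} x)\<^sup>2 \<le> indicator {0..h} x + indicator {1 - h..1} x"
proof -
  define t where "t x = max 0 (min 1 (min (x / h) ((1 - x) / h)))" for x :: real
  have c: "continuous_on UNIV t" unfolding t_def divide_inverse by (intro continuous_intros)
  have b: "\<bar>t x\<bar> \<le> 1" for x unfolding t_def by auto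
  have z: "t x = 0" if "x \<notin> {0<..<1}" for x
  proof -
    have "x / h \<le> 0 \<or> (1 - x) / h \<le> 0"
      using that h by (auto simp: divide_le_0_iff)
    then show ?thesis unfolding t_def by auto
  qed
  have i: "(t x - indicator {0<..1} x)\<^sup>2 \<le> indicator {0..h} x + indicator {1 - h..1} x" for x
  proof -
    consider "x \<notin> {0..1}" | "x \<in> {0..h} \<union> {1 - h..1}" | "h < x" "x < 1 - h"
      by fastforce
    then show ?thesis
    proof cases
      case 1
      then show ?thesis using z[of x] by (auto simp: indicator_def)
    next
      case 2
      have "0 \<le> t x" "t x \<le> 1" unfolding t_def by auto
      then have "\<bar>t x - indicator {0<..1} x\<bar> \<le> 1" by (auto simp: indicator_def)
      then have "(t x - indicator {0<..1} x)\<^sup>2 \<le> 1" by (simp add: abs_square_le_1)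
      also have "1 \<le> (indicator {0..h} x + indicator {1 - h..1} x :: real)"
        using 2 by (auto simp: indicator_def)
      finally show ?thesis .
    next
      case 3
      then have "x / h \<ge> 1" "(1 - x) / h \<ge> 1" using h by (auto simp: field_simps)
      then have "t x = 1" unfolding t_def by auto
      then show ?thesis using 3 h by (auto simp: indicator_def)
    qed
  qed
  show thesis by (rule that[OF c b z i])
qed

text \<open>Dividing \<open>t\<close> by the Gaussian gives \<open>w\<close>, which is approximated
  by an \<open>L\<close>-periodic trigonometric polynomial. The squared error carries two Gaussian
  factors: one is kept in the bound to make it integrable, the other beats the polynomial far out,
  where periodic copies of \<open>w\<close> appear.\<close>

lemma wave_approximation_tent:
  assumes t: "continuous_on UNIV t" "\<And>x. \<bar>t x\<bar> \<le> (1::real)" "\<And>x. x \<notin> {0<..<1} \<Longrightarrow> t x = 0"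
    and e: "0 < e"
  obtains cs where "\<And>x. (norm (wave cs (mat 1) x - of_real (t x)))\<^sup>2 \<le> e * exp (- pi * x\<^sup>2)"
proof -
  define w where "w x = t x * exp (pi * x\<^sup>2)" for x
  define W where "W = exp pi"
  have wW: "\<bar>w x\<bar> \<le> W" for x
  proof (cases "x \<in> {0..1}")
    case True
    then have "x\<^sup>2 \<le> 1" by (simp add: power_le_one)
    then have "exp (pi * x\<^sup>2) \<le> exp pi" by simp
    then have "\<bar>t x\<bar> * exp (pi * x\<^sup>2) \<le> 1 * exp pi" using t(2)[of x] by (intro mult_mono) auto
    then show ?thesis by (simp add: w_def W_def abs_mult)
  next
    case False
    then have "t x = 0" using t(3)[of x] by auto
    then show ?thesis by (simp add: w_def W_def)
  qed
  have contw: "continuous_on UNIV w" unfolding w_def by (intro continuous_intros t)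
  define d where "d = min 1 (sqrt e)"
  have d: "0 < d" "d \<le> 1" "d\<^sup>2 \<le> e"
  proof -
    have "d\<^sup>2 \<le> (sqrt e)\<^sup>2" using e by (intro power_mono) (auto simp: d_def)
    then show "d\<^sup>2 \<le> e" using e by simp
  qed (use e in \<open>auto simp: d_def\<close>)
  \<comment> \<open>The logarithm makes the tail at most \<open>e\<close>. \<open>L \<ge> 2\<close>
    keeps the support of \<open>w\<close> inside one period and ensures
    \<open>\<bar>x\<bar> \<ge> 1\<close> in the tail, whence
    \<open>\<bar>x\<bar> \<le> pi * x\<^sup>2\<close>.\<close>
  define L where "L = max 2 (1 + ln ((W + 1)\<^sup>2 / e))"
  have L: "L \<ge> 2" "(W + 1)\<^sup>2 * exp (- (L - 1)) \<le> e"
  proof -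
    have "0 < W + 1" by (simp add: W_def add_pos_pos)
    then have "0 < (W + 1)\<^sup>2 / e" using e by simp
    then have "(W + 1)\<^sup>2 / e = exp (ln ((W + 1)\<^sup>2 / e))" by simp
    also have "\<dots> \<le> exp (L - 1)" by (simp add: L_def)
    finally have "(W + 1)\<^sup>2 \<le> e * exp (L - 1)" using e by (simp add: field_simps)
    then have "(W + 1)\<^sup>2 * exp (- (L - 1)) \<le> e * exp (L - 1) * exp (- (L - 1))" by (intro mult_right_mono) auto
    also have "\<dots> = e" by (simp only: mult.assoc exp_add[symmetric]) simp
    finally show "(W + 1)\<^sup>2 * exp (- (L - 1)) \<le> e" .
  qed (simp add: L_def)
  obtain cs where cs: "\<And>y. y \<in> {0..1} \<Longrightarrow> norm (of_real (w (L * y)) - trig cs y) < d"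
  proof (rule trig_dense[of "\<lambda>y. w (L * y)" d])
    show "continuous_on {0..1} (\<lambda>y. w (L * y))"
      by (intro continuous_on_compose2[OF contw] continuous_intros) auto
    show "w (L * 0) = w (L * 1)" using t(3)[of L] t(3)[of 0] L by (simp add: w_def)
  qed (use d in auto)
  have trig_bound: "norm (trig cs y) \<le> W + 1" for y
  proof -
    have "trig cs y = trig cs (frac y)"
      using trig_periodic[of cs y "- \<lfloor>y\<rfloor>"] by (simp add: frac_def)
    moreover have "norm (of_real (w (L * frac y)) - trig cs (frac y)) < d"
      by (rule cs) (simp add: frac_ge_0 less_imp_le[OF frac_lt_1])
    moreover have "norm (complex_of_real (w (L * frac y))) \<le> W" using wW by simp
    ultimately show ?thesis using d norm_triangle_sub[of "trig cs (frac y)" "of_real (w (L * frac y))"]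
      by (simp add: norm_minus_commute)
  qed
  have "(norm (wave (map (\<lambda>(c, n). (c, of_int n / L)) cs) (mat 1) x - of_real (t x)))\<^sup>2 \<le> e * exp (- pi * x\<^sup>2)" for x
  proof -
    let ?E = "exp (- pi * x\<^sup>2)"
    let ?D = "norm (trig cs (x / L) - of_real (w x))"
    have "of_real (t x) = of_real ?E * complex_of_real (w x)"
    proof -
      have "?E * w x = t x" by (simp add: w_def exp_minus)
      then show ?thesis by (simp flip: of_real_mult)
    qed
    then have "norm (wave (map (\<lambda>(c, n). (c, of_int n / L)) cs) (mat 1) x - of_real (t x)) = ?E * ?D"
      unfolding wave_one by (simp flip: right_diff_distrib add: norm_mult)
    then have eq: "(norm (wave (map (\<lambda>(c, n). (c, of_int n / L)) cs) (mat 1) x - of_real (t x)))\<^sup>2 = ?E * (?E * ?D\<^sup>2)"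
      by (simp add: power_mult_distrib) (simp add: power2_eq_square)
    \<comment> \<open>On \<open>[- (L - 1), L]\<close> the polynomial is within \<open>d\<close> of
      \<open>w\<close>: for negative \<open>x\<close> in this range, \<open>x\<close> and
      \<open>x + L\<close> both lie outside the support of \<open>w\<close>.\<close>
    have "?E * ?D\<^sup>2 \<le> e"
    proof (cases "- (L - 1) \<le> x \<and> x \<le> L")
      case True
      have "?D < d"
      proof (cases "0 \<le> x")
        case True
        with \<open>- (L - 1) \<le> x \<and> x \<le> L\<close> L cs[of "x / L"] show ?thesis by (simp add: norm_minus_commute)
      next
        case False
        then have "x / L + of_int 1 \<in> {0..1}" using True L by (auto simp: field_simps)
        moreover have "L * (x / L + of_int 1) = x + L" using L by (simp add: distrib_left)
        ultimately have "norm (of_real (w (x + L)) - trig cs (x / L)) < d"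
          using cs[of "x / L + of_int 1"] by (simp only: trig_periodic)
        moreover have "w (x + L) = 0" "w x = 0"
        proof -
          have "t (x + L) = 0"
            using t(3)[of "x + L"] True by auto
          then show "w (x + L) = 0" by (simp add: w_def)
          show "w x = 0" using False t(3)[of x] by (simp add: w_def)
        qed
        ultimately show ?thesis by (simp add: norm_minus_commute)
      qed
      then have "?D\<^sup>2 \<le> d\<^sup>2" by (intro power_mono) auto
      then have "?E * ?D\<^sup>2 \<le> 1 * d\<^sup>2" by (intro mult_mono) auto
      then show ?thesis using d by simp
    next
      case False
      then have x: "L - 1 \<le> \<bar>x\<bar>" using L by linarith
      have "x \<notin> {0<..<1}" using False L by auto
      then have "w x = 0" using t(3) by (simp add: w_def)
      then have "?D\<^sup>2 \<le> (W + 1)\<^sup>2" using trig_bound by (intro power_mono) auto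
      moreover have "?E \<le> exp (- (L - 1))"
      proof -
        have "L - 1 \<le> \<bar>x\<bar> * 1" using x by simp
        also have "\<dots> \<le> \<bar>x\<bar> * \<bar>x\<bar>" using x L by (intro mult_left_mono) auto
        also have "\<dots> \<le> pi * x\<^sup>2" using pi_gt3 by (simp add: power2_eq_square mult_le_cancel_right1 not_less)
        finally show ?thesis by simp
      qed
      ultimately have "?E * ?D\<^sup>2 \<le> exp (- (L - 1)) * (W + 1)\<^sup>2" by (intro mult_mono) auto
      then show ?thesis using L by (simp add: mult.commute)
    qed
    then have "?E * (?E * ?D\<^sup>2) \<le> ?E * e" by (intro mult_left_mono) auto
    then show ?thesis unfolding eq by (simp add: mult.commute)
  qed
  with that show thesis by blast
qed

lemma norm_add_square_le:
  fixes x y :: "'a::real_normed_vector"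
  shows "(norm (x + y))\<^sup>2 \<le> 2 * (norm x)\<^sup>2 + 2 * (norm y)\<^sup>2"
proof -
  have "(norm (x + y))\<^sup>2 \<le> (norm x + norm y)\<^sup>2" by (intro power_mono norm_triangle_ineq) auto
  also have "\<dots> \<le> 2 * (norm x)\<^sup>2 + 2 * (norm y)\<^sup>2"
    using zero_le_power2[of "norm x - norm y"] by (simp add: power2_eq_square algebra_simps)
  finally show ?thesis .
qed

lemma nn_integral_norm_add_square_le:
  fixes f g :: "real \<Rightarrow> complex"
  assumes [measurable]: "f \<in> borel_measurable borel" "g \<in> borel_measurable borel"
    and f: "(\<integral>\<^sup>+x. ennreal ((norm (f x))\<^sup>2) \<partial>lborel) \<le> ennreal a"
    and g: "(\<integral>\<^sup>+x. ennreal ((norm (g x))\<^sup>2) \<partial>lborel) \<le> ennreal b"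
    and "0 \<le> a" "0 \<le> b"
  shows "(\<integral>\<^sup>+x. ennreal ((norm (f x + g x))\<^sup>2) \<partial>lborel) \<le> ennreal (2 * a + 2 * b)"
proof -
  have "(\<integral>\<^sup>+x. ennreal ((norm (f x + g x))\<^sup>2) \<partial>lborel) \<le>
     (\<integral>\<^sup>+x. 2 * ennreal ((norm (f x))\<^sup>2) + 2 * ennreal ((norm (g x))\<^sup>2) \<partial>lborel)"
  proof (rule nn_integral_mono)
    fix x
    have "ennreal ((norm (f x + g x))\<^sup>2) \<le> ennreal (2 * (norm (f x))\<^sup>2 + 2 * (norm (g x))\<^sup>2)"
      by (intro ennreal_leI norm_add_square_le)
    also have "\<dots> = 2 * ennreal ((norm (f x))\<^sup>2) + 2 * ennreal ((norm (g x))\<^sup>2)"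
      by (simp add: ennreal_plus ennreal_mult)
    finally show "ennreal ((norm (f x + g x))\<^sup>2) \<le> \<dots>" .
  qed
  also have "\<dots> = 2 * (\<integral>\<^sup>+x. ennreal ((norm (f x))\<^sup>2) \<partial>lborel) + 2 * (\<integral>\<^sup>+x. ennreal ((norm (g x))\<^sup>2) \<partial>lborel)"
    by (simp add: nn_integral_add nn_integral_cmult)
  also have "\<dots> \<le> 2 * ennreal a + 2 * ennreal b"
    by (intro add_mono mult_left_mono f g) auto
  also have "\<dots> = ennreal (2 * a + 2 * b)"
    using assms(5,6) by (simp add: ennreal_plus ennreal_mult)
  finally show ?thesis .
qed

text \<open>Open at 0 and closed at 1: for \<open>0 \<le> a < 1\<close> the point
  \<open>(n - a) / N\<close> lies in the interval exactly when
  \<open>1 \<le> n \<le> N\<close>.\<close>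

definition chi :: "real \<Rightarrow> complex" where
  "chi x = indicator {0<..1} x"

lemma borel_measurable_chi [measurable]: "chi \<in> borel_measurable borel"
  unfolding chi_def by measurable

lemma wave_approximation:
  assumes e: "0 < e"
  obtains cs where "(\<integral>\<^sup>+x. ennreal ((norm (wave cs (mat 1) x - chi x))\<^sup>2) \<partial>lborel) \<le> ennreal e"
proof -
  \<comment> \<open>The two errors \<open>h\<close> and \<open>2 * h\<close> combine to
    \<open>2 * h + 2 * (2 * h) = 6 * h\<close>, which is below \<open>e\<close>.\<close>
  define h where "h = e / 8"
  have h: "0 < h" using e by (simp add: h_def)
  obtain t :: "real \<Rightarrow> real" where tent: "continuous_on UNIV t" "\<And>x. \<bar>t x\<bar> \<le> 1" "\<And>x. x \<notin> {0<..<1} \<Longrightarrow> t x = 0"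
    "\<And>x. (t x - indicator {0<..1} x)\<^sup>2 \<le> indicator {0..h} x + indicator {1 - h..1} x"
    by (rule tent_approximation[OF h]) (rule that)
  have [measurable]: "t \<in> borel_measurable borel"
    by (rule borel_measurable_continuous_onI) (rule tent)
  obtain cs where cs: "\<And>x. (norm (wave cs (mat 1) x - of_real (t x)))\<^sup>2 \<le> h * exp (- pi * x\<^sup>2)"
    using wave_approximation_tent[OF tent(1-3) h] by blast
  have 1: "(\<integral>\<^sup>+x. ennreal ((norm (wave cs (mat 1) x - of_real (t x)))\<^sup>2) \<partial>lborel) \<le> ennreal h"
  proof -
    have "(\<integral>\<^sup>+x. ennreal ((norm (wave cs (mat 1) x - of_real (t x)))\<^sup>2) \<partial>lborel)
       \<le> (\<integral>\<^sup>+x. ennreal h * ennreal (exp (- pi * x\<^sup>2)) \<partial>lborel)"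
      using h cs by (intro nn_integral_mono) (simp flip: ennreal_mult add: ennreal_leI)
    also have "\<dots> = ennreal h"
      by (subst nn_integral_cmult) (simp, simp only: nn_integral_gaussian mult_1_right)
    finally show ?thesis .
  qed
  have 2: "(\<integral>\<^sup>+x. ennreal ((norm (of_real (t x) - chi x))\<^sup>2) \<partial>lborel) \<le> ennreal (2 * h)"
  proof -
    have "ennreal ((norm (of_real (t x) - chi x))\<^sup>2) \<le> indicator {0..h} x + indicator {1 - h..1} x" for x
    proof -
      have "of_real (t x) - chi x = of_real (t x - indicator {0<..1} x)"
        by (simp add: chi_def indicator_def)
      then have "(norm (of_real (t x) - chi x))\<^sup>2 = (t x - indicator {0<..1} x)\<^sup>2"
        by (simp del: of_real_diff)
      then have "ennreal ((norm (of_real (t x) - chi x))\<^sup>2) \<le> ennreal (indicator {0..h} x + indicator {1 - h..1} x)"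
        using tent(4)[of x] by (simp only: ennreal_leI)
      also have "\<dots> = indicator {0..h} x + indicator {1 - h..1} x"
        by (simp add: ennreal_plus ennreal_indicator)
      finally show ?thesis .
    qed
    then have "(\<integral>\<^sup>+x. ennreal ((norm (of_real (t x) - chi x))\<^sup>2) \<partial>lborel)
       \<le> (\<integral>\<^sup>+x. indicator {0..h} x + indicator {1 - h..1} x \<partial>lborel)"
      by (intro nn_integral_mono) auto
    also have "\<dots> = ennreal h + ennreal h"
      using h by (subst nn_integral_add) auto
    also have "\<dots> = ennreal (2 * h)"
      using h by (simp flip: ennreal_plus)
    finally show ?thesis .
  qed
  have "(\<integral>\<^sup>+x. ennreal ((norm ((wave cs (mat 1) x - of_real (t x)) + (of_real (t x) - chi x)))\<^sup>2) \<partial>lborel)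
      \<le> ennreal (2 * h + 2 * (2 * h))"
    using h by (intro nn_integral_norm_add_square_le 1 2) auto
  also have "\<dots> \<le> ennreal e" using h by (intro ennreal_leI) (simp add: h_def)
  finally show thesis by (intro that[of cs]) simp
qed

text \<open>Makes a difference of two waves a wave again, so that the isometry applies to
  it.\<close>

definition list_diff :: "(complex \<times> real) list \<Rightarrow> (complex \<times> real) list \<Rightarrow> (complex \<times> real) list" where
  "list_diff cs ds = cs @ map (\<lambda>(c, \<beta>). (- c, \<beta>)) ds"

lemma wave_list_diff: "wave (list_diff cs ds) g x = wave cs g x - wave ds g x"
proof -
  have "wave (map (\<lambda>(c, \<beta>). (- c, \<beta>)) ds) g x = - wave ds g x"
    by (induction ds) auto
  then show ?thesis by (simp add: list_diff_def wave_def)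
qed

lemma theta_wave_list_diff: "theta_wave (list_diff cs ds) g p = theta_wave cs g p - theta_wave ds g p"
proof -
  have "theta_wave (map (\<lambda>(c, \<beta>). (- c, \<beta>)) ds) g p = - theta_wave ds g p"
    by (induction ds) auto
  then show ?thesis by (simp add: list_diff_def theta_wave_def)
qed

lemma torus_energy_le:
  assumes "det g = 1" "0 \<le> r"
    and "(\<integral>\<^sup>+x. ennreal ((norm (wave cs (mat 1) x))\<^sup>2) \<partial>lborel) \<le> ennreal r"
  shows "torus_integral (\<lambda>p. (norm (theta_wave cs g p))\<^sup>2) \<le> r"
  using assms(2,3) unfolding energy_invariant[OF assms(1), symmetric] energy_eq[OF assms(1), symmetric]
  by (simp add: ennreal_le_iff)

subsection \<open>Closed horocycles\<close>

definition gauss_sum :: "real \<Rightarrow> nat \<Rightarrow> real \<Rightarrow> complex" where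
  "gauss_sum u N b = (\<Sum>n=1..N. unit_exp (u * (real n)\<^sup>2 / 2 + real n * b)) / of_real (sqrt (real N))"

text \<open>Continuous in \<open>a\<close>; it agrees with the Zak transform of
  \<open>cutoff_chirp u N\<close> for \<open>0 \<le> a < 1\<close>, beyond which that transform sums
  over other \<open>n\<close>.\<close>

definition shifted_gauss_sum :: "real \<Rightarrow> nat \<Rightarrow> real \<times> real \<Rightarrow> complex" where
  "shifted_gauss_sum u N = (\<lambda>(a, b). unit_exp (u * a\<^sup>2 / 2) * gauss_sum u N (b - u * a))"

text \<open>The image of \<open>chi\<close> under the operator that \<open>horocycle_wave\<close>
  exhibits on waves.\<close>

definition cutoff_chirp :: "real \<Rightarrow> nat \<Rightarrow> real \<Rightarrow> complex" where
  "cutoff_chirp u N x = unit_exp (u * x\<^sup>2 / 2) * chi (x / real N) / of_real (sqrt (real N))"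

lemma continuous_gauss_sum [continuous_intros]:
  "continuous_on S f \<Longrightarrow> continuous_on S (\<lambda>x. gauss_sum u N (f x))"
  unfolding gauss_sum_def divide_inverse by (intro continuous_intros)

lemma gauss_sum_add_1: "gauss_sum u N (b + 1) = gauss_sum u N b"
proof -
  have "unit_exp (u * (real n)\<^sup>2 / 2 + real n * (b + 1)) = unit_exp (u * (real n)\<^sup>2 / 2 + real n * b)" for n
    using unit_exp_int[of "int n"] by (simp add: ring_distribs unit_exp_add)
  then show ?thesis by (simp add: gauss_sum_def)
qed

lemma zak_cutoff_chirp:
  assumes "0 \<le> a" "a < 1" "0 < N"
  shows "((\<lambda>n. cutoff_chirp u N (of_int n - a) * unit_exp (of_int n * b)) has_sum shifted_gauss_sum u N (a, b)) UNIV"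
proof -
  let ?f = "\<lambda>n. cutoff_chirp u N (of_int n - a) * unit_exp (of_int n * b)"
  have chi: "chi ((of_int n - a) / real N) = (if n \<in> int ` {1..N} then 1 else 0)" for n
  proof -
    have "0 < (of_int n - a) / real N \<and> (of_int n - a) / real N \<le> 1 \<longleftrightarrow> 1 \<le> n \<and> n \<le> int N"
    proof -
      have "0 < (of_int n - a) / real N \<longleftrightarrow> a < of_int n" using assms by (simp add: zero_less_divide_iff)
      also have "\<dots> \<longleftrightarrow> 1 \<le> n" using assms by linarith
      finally have 1: "0 < (of_int n - a) / real N \<longleftrightarrow> 1 \<le> n" .
      have "(of_int n - a) / real N \<le> 1 \<longleftrightarrow> of_int n - a \<le> real N" using assms by (simp add: divide_le_eq)
      also have "\<dots> \<longleftrightarrow> n \<le> int N" using assms by linarith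
      finally show ?thesis using 1 by simp
    qed
    moreover have "n \<in> int ` {1..N} \<longleftrightarrow> 1 \<le> n \<and> n \<le> int N"
      by (auto simp: image_iff intro!: bexI[of _ "nat n"])
    ultimately show ?thesis by (simp add: chi_def indicator_def)
  qed
  have "(\<Sum>n\<in>int ` {1..N}. ?f n) = (\<Sum>n=1..N. unit_exp (u * (real n - a)\<^sup>2 / 2) * unit_exp (real n * b) / of_real (sqrt (real N)))"
    unfolding sum.reindex[OF inj_on_of_nat] o_def
    using chi[of "int _"] by (intro sum.cong) (auto simp: cutoff_chirp_def)
  also have "\<dots> = shifted_gauss_sum u N (a, b)"
    unfolding shifted_gauss_sum_def gauss_sum_def prod.case sum_divide_distrib sum_distrib_left times_divide_eq_right unit_exp_add[symmetric]
    by (intro sum.cong refl arg_cong2[of _ _ _ _ "(/)"] arg_cong[of _ _ unit_exp]) (simp add: power2_eq_square field_simps)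
  finally have "(\<Sum>n\<in>int ` {1..N}. ?f n) = shifted_gauss_sum u N (a, b)" .
  moreover have "(?f has_sum (\<Sum>n\<in>int ` {1..N}. ?f n)) UNIV"
    by (rule has_sum_finite_neutralI[of "int ` {1..N}"]) (auto simp: cutoff_chirp_def chi)
  ultimately show ?thesis by simp
qed

lemma cutoff_chirp_bound:
  assumes "0 < N"
  shows "norm (cutoff_chirp u N x) \<le> exp (real N) * exp (- \<bar>x\<bar>)"
proof (cases "x / real N \<in> {0<..1}")
  case True
  then have x: "\<bar>x\<bar> \<le> real N" using assms by (auto simp: divide_le_eq zero_less_divide_iff)
  have "norm (cutoff_chirp u N x) \<le> 1"
    using assms by (simp add: cutoff_chirp_def chi_def norm_mult norm_divide divide_le_eq_1 indicator_def)
  also have "1 \<le> exp (real N - \<bar>x\<bar>)" using x by simp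
  finally show ?thesis by (simp add: exp_diff exp_minus divide_inverse)
qed (simp add: cutoff_chirp_def chi_def)

lemma horocycle_wave:
  assumes N: "0 < N" and t: "real N = exp (t / 2)"
  shows "wave cs (upper_unipotent u ** geodesic_flow t) x =
    unit_exp (u * x\<^sup>2 / 2) * wave cs (mat 1) (x / real N) / of_real (sqrt (real N))"
proof -
  have "exp (- t / 2) = 1 / real N"
    unfolding t inverse_eq_divide[symmetric] exp_minus[symmetric] by simp
  then have g: "geodesic_flow t = dilation (1 / real N) ** mat 1"
    by (simp add: geodesic_flow_def dilation_def flip: t)
  have "wave cs (upper_unipotent u ** (dilation (1 / real N) ** mat 1)) x =
      unit_exp (u * x\<^sup>2 / 2) * wave cs (dilation (1 / real N) ** mat 1) x"
    using N by (intro wave_upper_unipotent) (simp add: det_mul)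
  also have "wave cs (dilation (1 / real N) ** mat 1) x = of_real (sqrt \<bar>1 / real N\<bar>) * wave cs (mat 1) (1 / real N * x)"
    using N by (intro wave_dilation) simp_all
  also have "complex_of_real (sqrt \<bar>1 / real N\<bar>) = 1 / of_real (sqrt (real N))"
    by (simp add: real_sqrt_divide)
  finally show ?thesis by (simp add: g)
qed

text \<open>Multiplication by the chirp is unitary and so is the normalized dilation by
  \<open>N\<close>; the distance on the line is therefore that of the original functions, whatever
  \<open>u\<close> and \<open>N\<close> are.\<close>

lemma horocycle_energy:
  fixes u :: real
  assumes N: "0 < N" and t: "real N = exp (t / 2)"
  defines "g \<equiv> upper_unipotent u ** geodesic_flow t"
  shows "ennreal (torus_integral (\<lambda>p. (norm (theta_wave cs g p - shifted_gauss_sum u N p))\<^sup>2))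
    = (\<integral>\<^sup>+x. ennreal ((norm (wave cs (mat 1) x - chi x))\<^sup>2) \<partial>lborel)"
proof -
  have detg: "det g = 1"
    unfolding g_def det_mul det_upper_unipotent by (simp add: geodesic_flow_def det_2 flip: exp_add)
  have [measurable]: "cutoff_chirp u N \<in> borel_measurable borel"
  proof -
    have [measurable]: "unit_exp \<in> borel_measurable borel"
      by (intro borel_measurable_continuous_onI continuous_intros)
    show ?thesis unfolding cutoff_chirp_def by measurable
  qed
  obtain K where K: "\<And>x. norm (wave cs g x) \<le> K * exp (- \<bar>x\<bar>)" using wave_bound[OF detg] by blast
  let ?f = "\<lambda>x. wave cs g x - cutoff_chirp u N x"
  have "ennreal (torus_integral (\<lambda>p. (norm (theta_wave cs g p - shifted_gauss_sum u N p))\<^sup>2)) = (\<integral>\<^sup>+x. ennreal ((norm (?f x))\<^sup>2) \<partial>lborel)"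
  proof (rule zak_parseval)
    show "norm (?f x) \<le> (K + exp (real N)) * exp (- \<bar>x\<bar>)" for x
      using norm_triangle_ineq4[of "wave cs g x" "cutoff_chirp u N x"] K[of x] cutoff_chirp_bound[OF N, of u x]
      by (simp add: ring_distribs)
    show "continuous_on (cbox (0, 0) (1, 1)) (\<lambda>p. theta_wave cs g p - shifted_gauss_sum u N p)"
      unfolding shifted_gauss_sum_def case_prod_beta divide_inverse by (intro continuous_intros detg)
    fix a b :: real assume ab: "0 \<le> a" "a < 1" "0 \<le> b" "b \<le> 1"
    have "((\<lambda>n. wave cs g (of_int n - a) * unit_exp (of_int n * b)) has_sum theta_wave cs g (a, b)) UNIV"
    proof -
      have "(\<lambda>n. wave cs g (of_int n - a) * unit_exp (of_int n * b)) summable_on UNIV"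
        by (rule summable_norm_bounded(1)[OF summable_translates[OF K]]) simp
      from has_sum_infsum[OF this] show ?thesis using zak_wave[OF detg, of cs a b] by (simp add: zak_def)
    qed
    from has_sum_add[OF this has_sum_uminusI[OF zak_cutoff_chirp[OF ab(1,2) N]]]
    show "theta_wave cs g (a, b) - shifted_gauss_sum u N (a, b) = zak ?f a b"
      unfolding zak_def by (intro infsumI[symmetric]) (simp add: left_diff_distrib)
  qed measurable
  also have "\<dots> = \<bar>real N\<bar> * (\<integral>\<^sup>+x. ennreal ((norm (?f (0 + real N * x)))\<^sup>2) \<partial>lborel)"
    using N by (intro nn_integral_real_affine) auto
  also have "\<dots> = (\<integral>\<^sup>+x. real N * ennreal ((norm (?f (real N * x)))\<^sup>2) \<partial>lborel)"
    by (subst nn_integral_cmult) auto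
  also have "\<dots> = (\<integral>\<^sup>+x. ennreal ((norm (wave cs (mat 1) x - chi x))\<^sup>2) \<partial>lborel)"
  proof (rule nn_integral_cong)
    fix x
    have "?f (real N * x) = unit_exp (u * (real N * x)\<^sup>2 / 2) * (wave cs (mat 1) x - chi x) / of_real (sqrt (real N))"
      using N by (simp add: g_def horocycle_wave[OF N t] cutoff_chirp_def right_diff_distrib diff_divide_distrib)
    then have "(norm (?f (real N * x)))\<^sup>2 = (norm (wave cs (mat 1) x - chi x))\<^sup>2 / real N"
      by (simp add: norm_mult norm_divide power_divide)
    then show "real N * ennreal ((norm (?f (real N * x)))\<^sup>2) = ennreal ((norm (wave cs (mat 1) x - chi x))\<^sup>2)"
      using N by (simp flip: ennreal_mult)
  qed
  finally show ?thesis .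
qed

subsection \<open>Averaging over the circle\<close>

definition circle_mean :: "(complex \<Rightarrow> real) \<Rightarrow> complex \<Rightarrow> real" where
  "circle_mean F z = integral {0..1} (\<lambda>t. F (unit_exp t * z))"

lemma continuous_circle_mean:
  assumes "continuous_on UNIV F"
  shows "continuous_on UNIV (circle_mean F)"
  unfolding circle_mean_def cbox_interval[symmetric]
  by (rule integral_continuous_on_param)
     (auto simp: case_prod_beta intro!: continuous_on_compose2[OF assms] continuous_intros)

lemma bounded_circle_mean:
  assumes F: "continuous_on UNIV F" and bdd: "bounded (range F)"
  shows "bounded (range (circle_mean F))"
proof -
  obtain B where B: "\<And>z. norm (F z) \<le> B"
    using bdd unfolding bounded_iff by auto
  have "norm (circle_mean F z) \<le> B * (1 - 0)" for z
    unfolding circle_mean_def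
    by (rule integral_bound) (auto intro!: continuous_on_compose2[OF F] continuous_intros B[unfolded real_norm_def])
  then show ?thesis unfolding bounded_iff by (intro exI[of _ "B * (1 - 0)"]) auto
qed

text \<open>The phase winds around the circle \<open>\<bar>l\<bar>\<close> times at constant speed,
  so neither \<open>l\<close> nor the starting point \<open>s\<close> affects the mean.\<close>

lemma integral_phase:
  assumes F: "continuous_on UNIV F" and "l \<noteq> 0"
  shows "integral {0..1} (\<lambda>q. F (unit_exp (of_int l * q + s) * z)) = circle_mean F z"
proof -
  have "unit_exp (x + 1) = unit_exp x" for x
    using unit_exp_int[of 1] by (simp add: unit_exp_add)
  then show ?thesis
    unfolding circle_mean_def using assms(2)
    by (intro integral_periodic[of "\<lambda>t. F (unit_exp t * z)"])
       (auto intro!: continuous_on_compose2[OF F] continuous_intros)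
qed

lemma circle_mean_rotate:
  assumes F: "continuous_on UNIV F" and u: "norm u = 1"
  shows "circle_mean F (u * z) = circle_mean F z"
proof -
  have "u = unit_exp (Arg2pi u / (2 * pi))"
    using Arg2pi_eq[of u] u by (simp add: unit_exp_def mult_ac)
  then obtain s where s: "u = unit_exp s" by blast
  show ?thesis
    using integral_phase[OF F, of 1 s z]
    unfolding s circle_mean_def[of F "unit_exp s * z"] by (simp add: unit_exp_add mult.assoc)
qed

subsection \<open>The Birkhoff sums\<close>

text \<open>The second coordinate accumulates \<open>p + m * \<alpha>\<close> for
  \<open>m < n\<close>, which gives \<open>n (n - 1) / 2\<close>. The integer parts stay existential
  since characters do not see them.\<close>

lemma skew_translation_iterate:
  "\<exists>i j :: int. (skew_translation \<alpha> ^^ n) (p, q) =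
     (p + real n * \<alpha> - of_int i, q + real n * p + real n * (real n - 1) / 2 * \<alpha> - of_int j)"
proof (induction n)
  case 0
  show ?case by (intro exI[of _ 0]) simp
next
  case (Suc n)
  then obtain i j :: int where ij: "(skew_translation \<alpha> ^^ n) (p, q) =
     (p + real n * \<alpha> - of_int i, q + real n * p + real n * (real n - 1) / 2 * \<alpha> - of_int j)" by blast
  define p' q' where "p' = p + real n * \<alpha> - of_int i"
    and "q' = q + real n * p + real n * (real n - 1) / 2 * \<alpha> - of_int j"
  have "(skew_translation \<alpha> ^^ Suc n) (p, q) = skew_translation \<alpha> (p', q')"
    by (simp add: ij p'_def q'_def)
  also have "\<dots> = (p' + \<alpha> - of_int \<lfloor>p' + \<alpha>\<rfloor>, q' + p' - of_int \<lfloor>q' + p'\<rfloor>)"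
    by (simp add: skew_translation_def frac_def)
  also have "\<dots> = (p + real (Suc n) * \<alpha> - of_int (i + \<lfloor>p' + \<alpha>\<rfloor>),
      q + real (Suc n) * p + real (Suc n) * (real (Suc n) - 1) / 2 * \<alpha> - of_int (i + j + \<lfloor>q' + p'\<rfloor>))"
    unfolding p'_def q'_def by (simp add: field_simps)
  finally show ?case by blast
qed

text \<open>Splitting \<open>n (n - 1) / 2\<close> into \<open>n^2 / 2 - n / 2\<close> isolates a
  quadratic phase with parameter \<open>l \<alpha>\<close>; everything else is linear in
  \<open>n\<close> or free of it.\<close>

lemma psi_iterate:
  "psi k l ((skew_translation \<alpha> ^^ n) (p, q)) =
     unit_exp (of_int l * q + of_int k * p) *
     unit_exp (of_int l * \<alpha> * (real n)\<^sup>2 / 2 + real n * (of_int l * p + (of_int k * \<alpha> - of_int l * \<alpha> / 2)))"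
proof -
  obtain i j :: int where ij: "(skew_translation \<alpha> ^^ n) (p, q) =
     (p + real n * \<alpha> - of_int i, q + real n * p + real n * (real n - 1) / 2 * \<alpha> - of_int j)"
    using skew_translation_iterate by blast
  have "of_int k * (p + real n * \<alpha> - of_int i) + of_int l * (q + real n * p + real n * (real n - 1) / 2 * \<alpha> - of_int j)
     = (of_int l * q + of_int k * p) + (of_int l * \<alpha> * (real n)\<^sup>2 / 2 + real n * (of_int l * p + (of_int k * \<alpha> - of_int l * \<alpha> / 2)))
       + of_int (- (k * i) - l * j)"
    by (simp add: field_simps power2_eq_square)
  then have "unit_exp (of_int k * (p + real n * \<alpha> - of_int i) + of_int l * (q + real n * p + real n * (real n - 1) / 2 * \<alpha> - of_int j))
     = unit_exp ((of_int l * q + of_int k * p) + (of_int l * \<alpha> * (real n)\<^sup>2 / 2 + real n * (of_int l * p + (of_int k * \<alpha> - of_int l * \<alpha> / 2)))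
       + of_int (- (k * i) - l * j))" by (rule arg_cong)
  then show ?thesis
    unfolding ij psi_def prod.case by (simp only: unit_exp_add unit_exp_int mult_1_right)
qed

lemma X_rv_eq:
  "X_rv k l N \<alpha> (p, q) = unit_exp (of_int l * q + of_int k * p) *
     gauss_sum (of_int l * \<alpha>) N (of_int l * p + (of_int k * \<alpha> - of_int l * \<alpha> / 2))"
  by (simp add: X_rv_def birkhoff_sum_def psi_iterate gauss_sum_def sum_distrib_left)

lemma expectation_torus2:
  assumes f: "continuous_on UNIV f"
  shows "prob_space.expectation torus2 f = torus_integral f"
proof -
  let ?S = "{0..<1::real} \<times> {0..<1::real}" and ?Q = "cbox (0::real, 0::real) (1, 1)"
  have S: "?S \<in> sets borel" by (simp flip: borel_prod)
  have Q: "set_integrable lborel ?Q f"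
    unfolding set_integrable_def
    by (rule borel_integrable_compact) (auto intro: continuous_on_subset[OF f])
  have sub: "?S \<subseteq> ?Q" by (auto simp: cbox_Pair_eq)
  have int: "set_integrable lborel ?S f"
    by (rule set_integrable_subset[OF Q]) (use S sub in auto)
  have "prob_space.expectation torus2 f = set_lebesgue_integral lborel ?S f"
    unfolding torus2_def set_lebesgue_integral_def
    using S by (subst integral_restrict_space) auto
  also have "\<dots> = integral ?S f" by (rule set_borel_integral_eq_integral(2)[OF int])
  also have "\<dots> = integral ?Q f"
  proof (rule integral_spike_set)
    have "box (0::real, 0::real) (1, 1) \<subseteq> ?S" by (force simp: box_def Basis_prod_def)
    then have "?Q - ?S \<subseteq> ?Q - box (0, 0) (1, 1)" by blast
    then have "negligible (?Q - ?S)"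
      by (rule negligible_subset[OF negligible_frontier_interval])
    then show "negligible {x \<in> ?Q - ?S. f x \<noteq> 0}" by (rule negligible_subset) auto
    show "negligible {x \<in> ?S - ?Q. f x \<noteq> 0}" using sub by (auto intro: negligible_subset[of "{}"])
  qed
  finally show ?thesis by (simp add: torus_integral_def)
qed

lemma expectation_X_rv:
  assumes F: "continuous_on UNIV F" and l: "l \<noteq> 0"
  shows "prob_space.expectation torus2 (\<lambda>x. F (X_rv k l N \<alpha> x)) =
    torus_integral (\<lambda>p. circle_mean F (shifted_gauss_sum (of_int l * \<alpha>) N p))"
proof -
  let ?u = "of_int l * \<alpha>" and ?s = "of_int k * \<alpha> - of_int l * \<alpha> / 2"
  let ?F = "circle_mean F"
  have cF: "continuous_on UNIV ?F" by (rule continuous_circle_mean[OF F])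
  have X: "(\<lambda>x. F (X_rv k l N \<alpha> x)) = (\<lambda>(p, q). F (unit_exp (of_int l * q + of_int k * p) * gauss_sum ?u N (of_int l * p + ?s)))"
    by (auto simp: X_rv_eq)
  have cX: "continuous_on UNIV (\<lambda>(p, q). F (unit_exp (of_int l * q + of_int k * p) * gauss_sum ?u N (of_int l * p + ?s)))"
    unfolding case_prod_beta by (intro continuous_on_compose2[OF F] continuous_intros) auto
  have "prob_space.expectation torus2 (\<lambda>x. F (X_rv k l N \<alpha> x)) = integral {0..1} (\<lambda>p. ?F (gauss_sum ?u N (of_int l * p + ?s)))"
    unfolding X expectation_torus2[OF cX] torus_integral_iterated[OF continuous_on_subset[OF cX subset_UNIV]] prod.case
      integral_phase[OF F l] ..
  also have "\<dots> = integral {0..1} (\<lambda>b. ?F (gauss_sum ?u N b))"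
    by (rule integral_periodic[of "\<lambda>b. ?F (gauss_sum ?u N b)", OF _ _ l])
       (auto simp: gauss_sum_add_1 intro!: continuous_on_compose2[OF cF] continuous_intros)
  \<comment> \<open>A dummy variable \<open>a\<close> enters here. The shear by
    \<open>- ?u * a\<close> and a phase then recreate the Zak transform of the cut-off chirp without
    changing the mean.\<close>
  also have "\<dots> = torus_integral (\<lambda>(a, b). ?F (gauss_sum ?u N b))"
  proof -
    have c: "continuous_on X (\<lambda>(a, b). ?F (gauss_sum ?u N b))" for X
      unfolding case_prod_beta by (intro continuous_on_compose2[OF cF] continuous_intros) auto
    show ?thesis unfolding torus_integral_iterated[OF c] by simp
  qed
  also have "\<dots> = torus_integral (\<lambda>(a, b). (\<lambda>(a, b). ?F (gauss_sum ?u N b)) (a, b + - ?u * a))"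
    by (rule torus_integral_shear[symmetric])
       (auto simp: case_prod_beta gauss_sum_add_1 intro!: continuous_on_compose2[OF cF] continuous_intros)
  also have "\<dots> = torus_integral (\<lambda>p. ?F (shifted_gauss_sum ?u N p))"
    by (intro arg_cong[of _ _ torus_integral])
       (auto simp: shifted_gauss_sum_def circle_mean_rotate[OF F])
  finally show ?thesis .
qed

subsection \<open>The limit function\<close>

lemma det_1_carrier: "carrier SL2R = {g. det g = 1}"
  by (simp add: SL2R_def)

lemma descend_to_quotient:
  assumes cont: "continuous_on {g. det g = 1} f"
    and inv: "\<And>\<gamma> g. \<gamma> \<in> SL2Z \<Longrightarrow> det g = 1 \<Longrightarrow> f (\<gamma> ** g) = f g"
  obtains \<nu> where "continuous_map SL2Z_quotient euclideanreal \<nu>"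
    "\<And>g. det g = 1 \<Longrightarrow> \<nu> (SL2Z #>\<^bsub>SL2R\<^esub> g) = f g"
proof -
  have eq: "f g = f h" if "det g = 1" and h: "det h = 1" and same: "SL2Z #>\<^bsub>SL2R\<^esub> g = SL2Z #>\<^bsub>SL2R\<^esub> h" for g h
  proof -
    have "mat 1 \<in> SL2Z" using subgroup.one_closed[OF subgroup_SL2Z] by (simp add: SL2R_def)
    then have "g \<in> SL2Z #>\<^bsub>SL2R\<^esub> g" unfolding r_coset_def by (auto simp: SL2R_def intro!: bexI[of _ "mat 1"])
    then have "g \<in> SL2Z #>\<^bsub>SL2R\<^esub> h" by (simp only: same)
    then obtain \<gamma> where "\<gamma> \<in> SL2Z" "g = \<gamma> ** h"
      unfolding r_coset_def by (auto simp: SL2R_def)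
    then show ?thesis using inv h by simp
  qed
  have cm: "continuous_map (top_of_set (carrier SL2R)) euclideanreal f"
    using cont by (simp add: det_1_carrier)
  show thesis
  proof (rule quotient_map_lift_exists[OF quotient_map_SL2Z_quotient cm])
    show "f g = f h" if "g \<in> topspace (top_of_set (carrier SL2R))" "h \<in> topspace (top_of_set (carrier SL2R))"
      "SL2Z #>\<^bsub>SL2R\<^esub> g = SL2Z #>\<^bsub>SL2R\<^esub> h" for g h
      by (rule eq[OF _ _ that(3)]) (use that(1,2) in \<open>simp_all add: det_1_carrier\<close>)
  next
    fix \<nu> assume "continuous_map SL2Z_quotient euclideanreal \<nu>"
      and "\<And>g. g \<in> topspace (top_of_set (carrier SL2R)) \<Longrightarrow> \<nu> (SL2Z #>\<^bsub>SL2R\<^esub> g) = f g"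
    then show thesis by (intro that[of \<nu>]) (simp_all add: det_1_carrier)
  qed
qed

theorem theorem1:
  fixes F :: "complex \<Rightarrow> real"
  assumes "continuous_on UNIV F" and "bounded (range F)"
  shows "\<exists>\<nu>. continuous_map SL2Z_quotient euclideanreal \<nu> \<and>
    (\<forall>(\<alpha>::real) (t::real) (N::nat) (k::int) (l::int).
       real N = exp (t / 2) \<and> l \<noteq> 0 \<longrightarrow>
       prob_space.expectation torus2 (\<lambda>x. F (X_rv k l N \<alpha> x)) =
         \<nu> (SL2Z #>\<^bsub>SL2R\<^esub> (upper_unipotent (of_int l * \<alpha>) \<otimes>\<^bsub>SL2R\<^esub> geodesic_flow t)))"
proof -
  let ?F = "circle_mean F" and ?G = "{g :: real^2^2. det g = 1}"
  note cF = continuous_circle_mean[OF assms(1)]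
  note rot = circle_mean_rotate[OF assms(1)]
  define err where "err j = 1 / real (Suc j)" for j
  have err: "0 < err j" "err j \<le> 1" for j by (auto simp: err_def)
  have "\<exists>cs. (\<integral>\<^sup>+x. ennreal ((norm (wave cs (mat 1) x - chi x))\<^sup>2) \<partial>lborel) \<le> ennreal (err j)" for j
    using wave_approximation[OF err(1)] by blast
  then obtain cs where cs: "\<And>j. (\<integral>\<^sup>+x. ennreal ((norm (wave (cs j) (mat 1) x - chi x))\<^sup>2) \<partial>lborel) \<le> ennreal (err j)"
    by metis
  have chi_energy: "(\<integral>\<^sup>+x. ennreal ((norm (chi x))\<^sup>2) \<partial>lborel) \<le> ennreal 1"
  proof -
    have "ennreal ((norm (chi x))\<^sup>2) = indicator {0<..1} x" for x
      by (simp add: chi_def indicator_def)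
    then show ?thesis by simp
  qed
  \<comment> \<open>The bound 4 comes from \<open>2 * err j + 2 * 1\<close> with
    \<open>err j \<le> 1\<close>.\<close>
  have wave_energy: "torus_integral (\<lambda>p. (norm (theta_wave (cs j) g p))\<^sup>2) \<le> 4" if g: "det g = 1" for j g
  proof (rule torus_energy_le[OF g])
    have "(\<integral>\<^sup>+x. ennreal ((norm ((wave (cs j) (mat 1) x - chi x) + chi x))\<^sup>2) \<partial>lborel) \<le> ennreal (2 * err j + 2 * 1)"
      using err(1)[of j] by (intro nn_integral_norm_add_square_le cs chi_energy) auto
    also have "\<dots> \<le> ennreal 4" using err[of j] by (intro ennreal_leI) simp
    finally show "(\<integral>\<^sup>+x. ennreal ((norm (wave (cs j) (mat 1) x))\<^sup>2) \<partial>lborel) \<le> ennreal 4" by simp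
  qed simp
  have diff_energy: "torus_integral (\<lambda>p. (norm (theta_wave (cs i) g p - theta_wave (cs j) g p))\<^sup>2) \<le> 2 * err i + 2 * err j"
    if g: "det g = 1" for i j g
  proof -
    have "(\<integral>\<^sup>+x. ennreal ((norm (chi x - wave (cs j) (mat 1) x))\<^sup>2) \<partial>lborel) \<le> ennreal (err j)"
      using cs[of j] by (simp add: norm_minus_commute)
    then have "(\<integral>\<^sup>+x. ennreal ((norm ((wave (cs i) (mat 1) x - chi x) + (chi x - wave (cs j) (mat 1) x)))\<^sup>2) \<partial>lborel) \<le> ennreal (2 * err i + 2 * err j)"
      using err(1)[of i] err(1)[of j] by (intro nn_integral_norm_add_square_le cs) auto
    then show ?thesis
      using torus_energy_le[OF g, of "2 * err i + 2 * err j" "list_diff (cs i) (cs j)"] err(1)[of i] err(1)[of j]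
      by (simp add: wave_list_diff theta_wave_list_diff)
  qed
  \<comment> \<open>One comparison for two purposes: \<open>H\<close> is another theta wave in the
    Cauchy argument and the shifted Gauss sum in the evaluation on horocycles. \<open>J\<close> is
    chosen before \<open>g\<close>, which yields uniformity; \<open>4 * err J\<close> dominates
    \<open>2 * err i + 2 * err j\<close> for \<open>i, j \<ge> J\<close>.\<close>
  have close: "\<exists>J. \<forall>j\<ge>J. \<forall>g H. det g = 1 \<longrightarrow> continuous_on UNIV H \<longrightarrow>
      torus_integral (\<lambda>p. (norm (theta_wave (cs j) g p - H p))\<^sup>2) \<le> 4 * err J \<longrightarrow>
      \<bar>theta_mean ?F (cs j) g - torus_integral (\<lambda>p. ?F (H p))\<bar> < e" if e: "e > 0" for e
  proof -
    obtain D where D: "D \<ge> 0" "\<And>z w. \<bar>?F z - ?F w\<bar> \<le> e / 10 * (1 + (norm z)\<^sup>2) + D * (norm (z - w))\<^sup>2"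
      using bounded_continuous_modulus[OF cF bounded_circle_mean[OF assms], of "e / 10"] e by auto
    \<comment> \<open>The tolerance splits evenly: \<open>e / 10 * (1 + 4)\<close> is
      \<open>e / 2\<close>, and this \<open>J\<close> keeps \<open>D * (4 * err J)\<close> below
      \<open>e / 2\<close>.\<close>
    obtain J where J: "8 * D / e < real J" using reals_Archimedean2 by blast
    have "D * (4 * err J) < e / 2"
    proof -
      have "8 * D < e * real (Suc J)" using J e by (simp add: field_simps)
      then show ?thesis by (simp add: err_def field_simps)
    qed
    then have small: "e / 10 * (1 + 4) + D * (4 * err J) < e" by simp
    have "\<bar>theta_mean ?F (cs j) g - torus_integral (\<lambda>p. ?F (H p))\<bar> < e"
      if g: "det g = 1" and H: "continuous_on UNIV H"
        and le: "torus_integral (\<lambda>p. (norm (theta_wave (cs j) g p - H p))\<^sup>2) \<le> 4 * err J" for j g H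
    proof -
      have "\<bar>theta_mean ?F (cs j) g - torus_integral (\<lambda>p. ?F (H p))\<bar> \<le>
        e / 10 * (1 + torus_integral (\<lambda>p. (norm (theta_wave (cs j) g p))\<^sup>2)) + D * torus_integral (\<lambda>p. (norm (theta_wave (cs j) g p - H p))\<^sup>2)"
        unfolding theta_mean_def
        by (rule torus_integral_close[OF cF D(2)]) (intro continuous_intros g H)+
      also have "\<dots> \<le> e / 10 * (1 + 4) + D * (4 * err J)"
        using e D(1) wave_energy[OF g, of j] le by (intro add_mono mult_left_mono) auto
      finally show ?thesis using small by simp
    qed
    then show ?thesis by blast
  qed
  have err_mono: "err j \<le> err J" if "J \<le> j" for j J
    using that by (simp add: err_def frac_le)
  \<comment> \<open>Every member of the sequence is invariant, so invariance of \<open>f\<close> is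
    an equality of sequences under \<open>lim\<close>; continuity comes from the uniform convergence
    shown next.\<close>
  define f where "f g = lim (\<lambda>j. theta_mean ?F (cs j) g)" for g
  have unif: "uniform_limit ?G (\<lambda>j. theta_mean ?F (cs j)) f sequentially"
    unfolding f_def uniformly_convergent_uniform_limit_iff[symmetric]
  proof (rule Cauchy_uniformly_convergent, rule uniformly_Cauchy_onI)
    fix e :: real assume "e > 0"
    then obtain J where J: "\<And>j g H. \<lbrakk>j \<ge> J; det g = 1; continuous_on UNIV H;
      torus_integral (\<lambda>p. (norm (theta_wave (cs j) g p - H p))\<^sup>2) \<le> 4 * err J\<rbrakk> \<Longrightarrow>
      \<bar>theta_mean ?F (cs j) g - torus_integral (\<lambda>p. ?F (H p))\<bar> < e"
      using close[of e] by blast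
    have "dist (theta_mean ?F (cs i) g) (theta_mean ?F (cs j) g) < e" if "g \<in> ?G" "i \<ge> J" "j \<ge> J" for g i j
    proof -
      have g: "det g = 1" using that by simp
      have "2 * err i + 2 * err j \<le> 4 * err J" using err_mono[OF that(2)] err_mono[OF that(3)] by simp
      then have "torus_integral (\<lambda>p. (norm (theta_wave (cs i) g p - theta_wave (cs j) g p))\<^sup>2) \<le> 4 * err J"
        using diff_energy[OF g, of i j] by simp
      from J[OF that(2) g _ this] show ?thesis
        by (simp add: dist_real_def theta_mean_def continuous_intros g)
    qed
    then show "\<exists>M. \<forall>g\<in>?G. \<forall>m\<ge>M. \<forall>n\<ge>M. dist (theta_mean ?F (cs m) g) (theta_mean ?F (cs n) g) < e"
      by blast
  qed
  have contf: "continuous_on ?G f"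
    by (rule uniform_limit_theorem[OF _ unif]) (auto intro!: always_eventually continuous_theta_mean cF)
  have invf: "f (\<gamma> ** g) = f g" if "\<gamma> \<in> SL2Z" "det g = 1" for \<gamma> g
    unfolding f_def using theta_mean_SL2Z[OF cF rot that] by simp
  obtain \<nu> where \<nu>: "continuous_map SL2Z_quotient euclideanreal \<nu>"
    "\<And>g. det g = 1 \<Longrightarrow> \<nu> (SL2Z #>\<^bsub>SL2R\<^esub> g) = f g"
    using descend_to_quotient[OF contf invf] by blast
  have "prob_space.expectation torus2 (\<lambda>x. F (X_rv k l N \<alpha> x)) =
         \<nu> (SL2Z #>\<^bsub>SL2R\<^esub> (upper_unipotent (of_int l * \<alpha>) \<otimes>\<^bsub>SL2R\<^esub> geodesic_flow t))"
    if t: "real N = exp (t / 2)" and l: "l \<noteq> 0" for \<alpha> t N k l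
  proof -
    let ?u = "of_int l * \<alpha>"
    define g where "g = upper_unipotent ?u ** geodesic_flow t"
    define H where "H = shifted_gauss_sum ?u N"
    have N: "0 < N" using t by (metis exp_gt_zero of_nat_0_less_iff)
    have g: "det g = 1"
      unfolding g_def det_mul det_upper_unipotent by (simp add: geodesic_flow_def det_2 flip: exp_add)
    have contH: "continuous_on UNIV H"
      unfolding H_def shifted_gauss_sum_def case_prod_beta divide_inverse by (intro continuous_intros)
    have energy: "torus_integral (\<lambda>p. (norm (theta_wave (cs j) g p - H p))\<^sup>2) \<le> err j" for j
      using cs[of j] err(1)[of j] horocycle_energy[OF N t, where cs = "cs j" and u = ?u]
      unfolding g_def[symmetric] H_def[symmetric] by (metis ennreal_le_iff less_imp_le)
    have "(\<lambda>j. theta_mean ?F (cs j) g) \<longlonglongrightarrow> torus_integral (\<lambda>p. ?F (H p))"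
    proof (rule LIMSEQ_I)
      fix e :: real assume "e > 0"
      then obtain J where J: "\<And>j g H. \<lbrakk>j \<ge> J; det g = 1; continuous_on UNIV H;
        torus_integral (\<lambda>p. (norm (theta_wave (cs j) g p - H p))\<^sup>2) \<le> 4 * err J\<rbrakk> \<Longrightarrow>
        \<bar>theta_mean ?F (cs j) g - torus_integral (\<lambda>p. ?F (H p))\<bar> < e"
        using close[of e] by blast
      have "\<bar>theta_mean ?F (cs j) g - torus_integral (\<lambda>p. ?F (H p))\<bar> < e" if "j \<ge> J" for j
        using energy[of j] err_mono[OF that] err(1)[of J] by (intro J that g contH) simp
      then show "\<exists>J. \<forall>j\<ge>J. norm (theta_mean ?F (cs j) g - torus_integral (\<lambda>p. ?F (H p))) < e"
        by auto
    qed
    then have "f g = torus_integral (\<lambda>p. ?F (H p))"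
      unfolding f_def by (rule limI)
    then show ?thesis
      using \<nu>(2)[OF g] expectation_X_rv[OF assms(1) l, of k N \<alpha>]
      by (simp add: SL2R_def g_def H_def)
  qed
  then show ?thesis using \<nu>(1) by blast
qed

end
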